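(* Let $n,m\ge 1$ be integers, $0<p<\infty$, $s_1,\ldots,s_m>-1$, and let $\mu$ be a positive Borel measure on $\mathbb R^{n+1}_+$. Then the following conditions are equivalent: $1^o$. The measure $\mu$ satisfies a Carleson type condition: there is a constant $C$ such that $$\frac{\mu(\Delta_k)}{|\Delta_k|^{m+\frac{1}{n+1}\sum_{j=1}^m s_j}}\le C,\qquad k\ge 1.$$ $2^o$. The trace operator ${\rm Tr}$ is bounded from $A^p_{\overrightarrow{s}}$ to $L^p(\mathbb R^{n+1}_+,d\mu)$. $3^o$. The trace operator ${\rm Tr}$ is bounded from $\tilde hA^p_{\overrightarrow{s}}$ to $L^p(\mathbb R^{n+1}_+,d\mu)$. $4^o$. There is a constant $C$ such that whenever $f_j\in A^p_{s_j}$ for $1\le j\le m$, $$\int_{\mathbb R^{n+1}_+}\prod_{j=1}^m|f_j(z)|^p\,d\mu(z)\le C\prod_{j=1}^m\|f_j\|_{A^p_{s_j}}^p.$$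
   Context: $\mathbb R^{n+1}_+=\{(x,t):x\in\mathbb R^n,\ t>0\}$; points are written $z=(x,t)$; $dm_\lambda(z)=t^\lambda\,dx\,dt$ for $\lambda\in\mathbb R$; $|E|$ is the Lebesgue measure of $E$. $h(\Omega)$ is the space of all harmonic functions on a domain $\Omega$. In particular $h((\mathbb R^{n+1}_+)^m)$ is the space of functions harmonic on $(\mathbb R^{n+1}_+)^m$ regarded as a domain in $\mathbb R^{m(n+1)}$. $\tilde h((\mathbb R^{n+1}_+)^m)$ is the space of functions $f(z_1,\ldots,z_m)$ on $(\mathbb R^{n+1}_+)^m$ that are harmonic in each of the variables $z_1,\ldots,z_m\in\mathbb R^{n+1}_+$ separately. For $\lambda>-1$, $0<p<\infty$: $A^p_\lambda=\{f\in h(\mathbb R^{n+1}_+):\|f\|_{A^p_\lambda}=(\int_{\mathbb R^{n+1}_+}|f|^p\,dm_\lambda)^{1/p}<\infty\}$. For $\overrightarrow{s}=(s_1,\ldots,s_m)$ with $s_j>-1$: $A^p_{\overrightarrow{s}}=h((\mathbb R^{n+1}_+)^m)\cap L^p((\mathbb R^{n+1}_+)^m,dm_{s_1}(z_1)\cdots dm_{s_m}(z_m))$, with the corresponding $L^p$ (quasi)norm, and $\tilde hA^p_{\overrightarrow{s}}=A^p_{\overrightarrow{s}}\cap\tilde h((\mathbb R^{n+1}_+)^m)$. For $f:(\mathbb R^{n+1}_+)^m\to\mathbb C$, ${\rm Tr}f(z)=f(z,\ldots,z)$, $z\in\mathbb R^{n+1}_+$. Boundedness of ${\rm Tr}$ from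 $X$ to $L^p(d\mu)$ means $\|{\rm Tr}f\|_{L^p(d\mu)}\le C\|f\|_X$ for all $f\in X$. $\{\Delta_k\}_{k\ge1}$ is a fixed Whitney decomposition of $\mathbb R^{n+1}_+$: closed cubes in $\mathbb R^{n+1}_+$ with sides parallel to the coordinate axes, with pairwise disjoint interiors, $\bigcup_k\Delta_k=\mathbb R^{n+1}_+$, ${\rm diam}\,\Delta_k\asymp{\rm dist}(\Delta_k,\partial\mathbb R^{n+1}_+)$ uniformly in $k$, and such that the cubes $\Delta_k^\ast$, with the same centers $(\xi_k,\eta_k)$ as $\Delta_k$ but enlarged $5/4$ times, form a finitely overlapping covering of $\mathbb R^{n+1}_+$ (so $\Delta_k^*\subset\mathbb R^{n+1}_+$ and $\sum_k\chi_{\Delta_k^\ast}\le C_n$), with $t\asymp\eta_k$ for $(x,t)\in\Delta_k^\ast$. *)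

theory Defs
  imports "HOL-Analysis.Analysis"
begin

definition dir_deriv :: "'a::euclidean_space \<Rightarrow> ('a \<Rightarrow> complex) \<Rightarrow> 'a \<Rightarrow> complex" where
  "dir_deriv b f x = frechet_derivative f (at x) b"

definition C2_on :: "'a::euclidean_space set \<Rightarrow> ('a \<Rightarrow> complex) \<Rightarrow> bool" where
  "C2_on \<Omega> f \<longleftrightarrow>
     (\<forall>x\<in>\<Omega>. f differentiable (at x)) \<and>
     (\<forall>b\<in>Basis. \<forall>x\<in>\<Omega>. dir_deriv b f differentiable (at x)) \<and>
     (\<forall>b\<in>Basis. \<forall>b'\<in>Basis. continuous_on \<Omega> (dir_deriv b' (dir_deriv b f)))"

definition laplacian :: "('a::euclidean_space \<Rightarrow> complex) \<Rightarrow> 'a \<Rightarrow> complex" where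
  "laplacian f x = (\<Sum>b\<in>Basis. dir_deriv b (dir_deriv b f) x)"

definition harmonic_on :: "'a::euclidean_space set \<Rightarrow> ('a \<Rightarrow> complex) \<Rightarrow> bool" where
  "harmonic_on \<Omega> f \<longleftrightarrow> C2_on \<Omega> f \<and> (\<forall>x\<in>\<Omega>. laplacian f x = 0)"

definition Lp :: "'a measure \<Rightarrow> real \<Rightarrow> ('a \<Rightarrow> complex) set" where
  "Lp M p = {f \<in> borel_measurable M. integrable M (\<lambda>x. norm (f x) powr p)}"

text \<open>For \<open>p < 1\<close> this is only a quasinorm. It is meaningful for members of \<open>Lp M p\<close>
  only, since the integral of a non-integrable function is 0.\<close>

definition Lp_norm :: "'a measure \<Rightarrow> real \<Rightarrow> ('a \<Rightarrow> complex) \<Rightarrow> real" where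
  "Lp_norm M p f = (LINT x|M. norm (f x) powr p) powr (1 / p)"

text \<open>Points of $\mathbb R^{n+1}$ are pairs \<open>(x, t)\<close>, with \<open>n = CARD('n)\<close>; points of
  $(\mathbb R^{n+1})^m$ are vectors of such pairs, with \<open>m = CARD('m)\<close>. Functions are total,
  but nothing below depends on their values off the (product) half-space, because the measures
  live on the half-space only.\<close>

type_synonym 'n point = "(real ^ 'n) \<times> real"

definition halfspace :: "'n::finite point set" where
  "halfspace = {z. snd z > 0}"

definition halfspace_pow :: "('n::finite point ^ 'm::finite) set" where
  "halfspace_pow = {Z. \<forall>j. Z $ j \<in> halfspace}"

definition weighted_measure :: "real \<Rightarrow> 'n::finite point measure" where
  "weighted_measure a =
     density (restrict_space lborel halfspace) (\<lambda>z. ennreal (snd z powr a))"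

text \<open>The product measure $dm_{s_1}(z_1)\cdots dm_{s_m}(z_m)$, written as a density with respect
  to Lebesgue measure on $\mathbb R^{m(n+1)}$.\<close>

definition weighted_measure_pow :: "('m::finite \<Rightarrow> real) \<Rightarrow> ('n::finite point ^ 'm) measure" where
  "weighted_measure_pow s =
     density (restrict_space lborel halfspace_pow) (\<lambda>Z. ennreal (\<Prod>j\<in>UNIV. snd (Z $ j) powr s j))"

definition bergman :: "real \<Rightarrow> real \<Rightarrow> ('n::finite point \<Rightarrow> complex) set" where
  "bergman p a = {f. harmonic_on halfspace f} \<inter> Lp (weighted_measure a) p"

definition bergman_pow ::
    "real \<Rightarrow> ('m::finite \<Rightarrow> real) \<Rightarrow> ('n::finite point ^ 'm \<Rightarrow> complex) set" where
  "bergman_pow p s = {f. harmonic_on halfspace_pow f} \<inter> Lp (weighted_measure_pow s) p"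

definition separately_harmonic :: "('n::finite point ^ 'm::finite \<Rightarrow> complex) \<Rightarrow> bool" where
  "separately_harmonic f \<longleftrightarrow>
     (\<forall>Z\<in>halfspace_pow. \<forall>j. harmonic_on halfspace (\<lambda>w. f (\<chi> i. if i = j then w else Z $ i)))"

definition sep_bergman_pow ::
    "real \<Rightarrow> ('m::finite \<Rightarrow> real) \<Rightarrow> ('n::finite point ^ 'm \<Rightarrow> complex) set" where
  "sep_bergman_pow p s = bergman_pow p s \<inter> {f. separately_harmonic f}"

definition Tr :: "('n::finite point ^ 'm::finite \<Rightarrow> complex) \<Rightarrow> 'n point \<Rightarrow> complex" where
  "Tr f z = f (\<chi> j. z)"

definition trace_bounded ::
    "('n::finite point ^ 'm::finite \<Rightarrow> complex) set \<Rightarrow> real \<Rightarrow> ('m \<Rightarrow> real) \<Rightarrow> 'n point measure \<Rightarrow> bool"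
  where
  "trace_bounded X p s \<mu> \<longleftrightarrow>
     (\<exists>C. \<forall>f\<in>X. Tr f \<in> Lp \<mu> p \<and> Lp_norm \<mu> p (Tr f) \<le> C * Lp_norm (weighted_measure_pow s) p f)"

definition cube :: "'a::euclidean_space \<Rightarrow> real \<Rightarrow> 'a set" where
  "cube c l = cbox (c - (l / 2) *\<^sub>R One) (c + (l / 2) *\<^sub>R One)"

definition whitney_decomposition :: "(nat \<Rightarrow> 'n::finite point set) \<Rightarrow> bool" where
  "whitney_decomposition \<Delta> \<longleftrightarrow>
     (\<exists>c l.
        (\<forall>k. l k > 0 \<and> \<Delta> k = cube (c k) (l k)) \<and>
        (\<forall>j k. j \<noteq> k \<longrightarrow> interior (\<Delta> j) \<inter> interior (\<Delta> k) = {}) \<and>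
        (\<Union>k. \<Delta> k) = halfspace \<and>
        (\<exists>a>0. \<exists>b>0. \<forall>k.
           a * setdist (\<Delta> k) (frontier halfspace) \<le> diameter (\<Delta> k) \<and>
           diameter (\<Delta> k) \<le> b * setdist (\<Delta> k) (frontier halfspace)) \<and>
        (\<Union>k. cube (c k) (5 / 4 * l k)) = halfspace \<and>
        (\<exists>N. \<forall>z. finite {k. z \<in> cube (c k) (5 / 4 * l k)} \<and>
                 card {k. z \<in> cube (c k) (5 / 4 * l k)} \<le> N) \<and>
        (\<exists>a>0. \<exists>b>0. \<forall>k. \<forall>z \<in> cube (c k) (5 / 4 * l k).
           a * snd (c k) \<le> snd z \<and> snd z \<le> b * snd (c k)))"

definition carleson ::
    "(nat \<Rightarrow> 'n::finite point set) \<Rightarrow> ('m::finite \<Rightarrow> real) \<Rightarrow> 'n point measure \<Rightarrow> bool" where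
  "carleson \<Delta> s \<mu> \<longleftrightarrow>
     (\<exists>C::real. \<forall>k.
        emeasure \<mu> (\<Delta> k) /
          ennreal (measure lborel (\<Delta> k) powr
            (real CARD('m) + 1 / (real CARD('n) + 1) * (\<Sum>j\<in>UNIV. s j)))
        \<le> ennreal C)"

definition product_bounded ::
    "real \<Rightarrow> ('m::finite \<Rightarrow> real) \<Rightarrow> 'n::finite point measure \<Rightarrow> bool" where
  "product_bounded p s \<mu> \<longleftrightarrow>
     (\<exists>C::real. \<forall>f. (\<forall>j. f j \<in> bergman p (s j)) \<longrightarrow>
        (\<integral>\<^sup>+z. ennreal (\<Prod>j\<in>UNIV. norm (f j z) powr p) \<partial>\<mu>)
          \<le> ennreal (C * (\<Prod>j\<in>UNIV. Lp_norm (weighted_measure (s j)) p (f j) powr p)))"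

end

theory Submission
  imports Defs
begin

text \<open>
  The four conditions are linked in a cycle, Carleson condition, trace inequality on \<open>bergman_pow\<close>,
  trace inequality on \<open>sep_bergman_pow\<close>, product inequality, Carleson condition. The second
  implication holds because the space shrinks; the other three carry the content.

  Carleson implies trace (\<open>carleson_imp_trace_bounded\<close>). If \<open>f\<close> is harmonic near a cube of side
  \<open>2 * r\<close> in a space of dimension \<open>V\<close>, then \<open>|f|^p\<close> at the centre is at most a constant times
  \<open>r^(-V)\<close> times the integral of \<open>|f|^p\<close> over the cube, for every \<open>p > 0\<close>
  (\<open>norm_powr_le_cube_average\<close>). This is used in dimension \<open>V = m (n + 1)\<close> at the diagonal
  points over a Whitney cube \<open>\<Delta>\<close> with centre \<open>(\<xi>, \<eta>)\<close>, with a radius so small that the cube of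
  integration stays inside the \<open>m\<close>-th power of the enlarged cube \<open>\<Delta>\<^sup>*\<close>. There the weights are
  comparable to powers of \<open>\<eta>\<close>, so the integral of \<open>|Tr f|^p\<close> over \<open>\<Delta>\<close> is at most a constant times
  the weighted integral of \<open>|f|^p\<close> over that power, the Carleson condition having exactly the
  exponent that cancels \<open>\<eta>\<close>. Since the enlarged cubes overlap boundedly, so do their powers, and
  summation over the cubes gives the inequality.

  The pointwise bound starts from a mean value property with the bump function
  \<open>max 0 (1 - |y|\<^sup>2)\<close> in place of surface measure. The integral of \<open>bump y * f (c + e y)\<close> over \<open>y\<close>
  does not depend on \<open>e\<close>: its derivative involves \<open>bump y * y\<close>, which is a multiple of the
  gradient of \<open>(bump y)\<^sup>2\<close>, and an integration by parts turns it into the integral of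
  the Laplacian of \<open>f\<close> against \<open>(bump y)\<^sup>2\<close>. This gives the case \<open>p = 1\<close>. The step to other \<open>p\<close> is
  elementary for \<open>p > 1\<close>, and for \<open>p < 1\<close> it is the argument of Hardy and Littlewood that maximises
  \<open>|f|\<close> times a power of the distance to the boundary.

  Trace implies product (\<open>trace_bounded_imp_product_bounded\<close>). The function
  \<open>f_1(z_1) * ... * f_m(z_m)\<close> is harmonic, jointly and in each variable; by Fubini its norm is the
  product of the norms of the factors, and its trace is their pointwise product.

  Product implies Carleson (\<open>product_bounded_imp_carleson\<close>). The test functions are translates of
  the Kelvin transform \<open>(t + \<i> x_1)^l / |z|^(2 l + n - 1)\<close> of a harmonic polynomial, with the pole at
  the reflection \<open>(\<xi>, - \<eta>)\<close> of the centre of the cube. They decay like \<open>|z|^(- (l + n - 1))\<close>, so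
  that for large \<open>l\<close> they belong to all the spaces in question, with norms computed by scaling.
  Because \<open>t + \<i> x_1\<close> has no zero where \<open>t > 0\<close>, they are bounded below on the whole
  cube, which is what makes one test function per cube sufficient.
\<close>

section \<open>Directional derivatives and harmonic functions\<close>

lemma sum_inner_Basis_scaleR:
  fixes b :: "'a::euclidean_space" and F :: "'a \<Rightarrow> 'b::real_vector"
  assumes "b \<in> Basis"
  shows "(\<Sum>b'\<in>Basis. (b \<bullet> b') *\<^sub>R F b') = F b"
proof -
  have "(\<Sum>b'\<in>Basis. (b \<bullet> b') *\<^sub>R F b') = (\<Sum>b'\<in>Basis. if b' = b then F b' else 0)"
    using assms by (intro sum.cong) (auto simp: inner_Basis)
  then show ?thesis using assms by simp
qed

lemma dir_deriv_eqI: "(f has_derivative f') (at x) \<Longrightarrow> dir_deriv b f x = f' b"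
  unfolding dir_deriv_def by (metis frechet_derivative_at)

lemma has_derivative_dir_deriv:
  fixes f :: "'a::euclidean_space \<Rightarrow> complex"
  assumes "f differentiable (at x)"
  shows "(f has_derivative (\<lambda>h. \<Sum>b\<in>Basis. (h \<bullet> b) *\<^sub>R dir_deriv b f x)) (at x)"
proof -
  have f: "(f has_derivative frechet_derivative f (at x)) (at x)"
    using assms by (simp add: frechet_derivative_works)
  then interpret linear "frechet_derivative f (at x)"
    by (rule has_derivative_linear)
  have "frechet_derivative f (at x) h = (\<Sum>b\<in>Basis. (h \<bullet> b) *\<^sub>R dir_deriv b f x)" for h
  proof -
    have "frechet_derivative f (at x) h = frechet_derivative f (at x) (\<Sum>b\<in>Basis. (h \<bullet> b) *\<^sub>R b)"
      by (simp add: euclidean_representation)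
    then show ?thesis by (simp add: sum scale dir_deriv_def)
  qed
  then show ?thesis
    by (intro has_derivative_eq_rhs[OF f]) auto
qed

text \<open>
  Harmonicity follows from formulas for the first derivative and for the derivatives of its
  components. The formulas are needed on \<open>\<Omega>\<close> only, and \<open>f'' b x\<close> is the derivative of the
  partial derivative of \<open>f\<close> in direction \<open>b\<close>.
\<close>

lemma harmonic_onI:
  fixes f :: "'a::euclidean_space \<Rightarrow> complex"
  assumes "open \<Omega>"
    and f: "\<And>x. x \<in> \<Omega> \<Longrightarrow> (f has_derivative f' x) (at x)"
    and f': "\<And>b x. b \<in> Basis \<Longrightarrow> x \<in> \<Omega> \<Longrightarrow> ((\<lambda>x. f' x b) has_derivative f'' b x) (at x)"
    and cont: "\<And>b b'. b \<in> Basis \<Longrightarrow> b' \<in> Basis \<Longrightarrow> continuous_on \<Omega> (\<lambda>x. f'' b x b')"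
    and lap: "\<And>x. x \<in> \<Omega> \<Longrightarrow> (\<Sum>b\<in>Basis. f'' b x b) = 0"
  shows "harmonic_on \<Omega> f"
proof -
  have D1: "dir_deriv b f x = f' x b" if "x \<in> \<Omega>" for b x
    using f[OF that] by (rule dir_deriv_eqI)
  have D2: "(dir_deriv b f has_derivative f'' b x) (at x)" if "x \<in> \<Omega>" "b \<in> Basis" for b x
    by (rule has_derivative_transform_within_open[OF f' \<open>open \<Omega>\<close>]) (use that D1 in auto)
  have D3: "dir_deriv b' (dir_deriv b f) x = f'' b x b'" if "x \<in> \<Omega>" "b \<in> Basis" for b b' x
    using D2[OF that] by (rule dir_deriv_eqI)
  have "C2_on \<Omega> f"
    unfolding C2_on_def
  proof (intro conjI ballI)
    fix b b' :: 'a assume b: "b \<in> Basis" "b' \<in> Basis"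
    show "continuous_on \<Omega> (dir_deriv b' (dir_deriv b f))"
      using cont[OF b] by (subst continuous_on_cong[OF refl D3]) (use b in auto)
  qed (use f D2 in \<open>auto simp: differentiable_def\<close>)
  then show ?thesis
    using lap by (simp add: harmonic_on_def laplacian_def D3)
qed

lemma harmonic_on_imp_continuous_on: "harmonic_on \<Omega> f \<Longrightarrow> continuous_on \<Omega> f"
  unfolding harmonic_on_def C2_on_def
  by (auto intro!: continuous_at_imp_continuous_on differentiable_imp_continuous_within)

lemma harmonic_on_imp_continuous_on_dir_deriv:
  "harmonic_on \<Omega> f \<Longrightarrow> b \<in> Basis \<Longrightarrow> continuous_on \<Omega> (dir_deriv b f)"
  unfolding harmonic_on_def C2_on_def
  by (auto intro!: continuous_at_imp_continuous_on differentiable_imp_continuous_within)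

section \<open>A mean value property over cubes\<close>

lemma mem_cube: "x \<in> cube c l \<longleftrightarrow> (\<forall>b\<in>Basis. \<bar>x \<bullet> b - c \<bullet> b\<bar> \<le> l / 2)"
proof -
  have "(c - (l / 2) *\<^sub>R One) \<bullet> b \<le> x \<bullet> b \<and> x \<bullet> b \<le> (c + (l / 2) *\<^sub>R One) \<bullet> b
      \<longleftrightarrow> \<bar>x \<bullet> b - c \<bullet> b\<bar> \<le> l / 2" if "b \<in> Basis" for b
  proof -
    have "One \<bullet> b = 1" using that by simp
    then show ?thesis
      by (simp only: inner_diff_left inner_add_left inner_scaleR_left mult_1_right) arith
  qed
  then show ?thesis unfolding cube_def mem_box by auto
qed

text \<open>
  Squaring smooths the kink of the positive part. This is why the square of the bump function below
  can be differentiated everywhere, while the bump function itself cannot.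
\<close>

lemma has_real_derivative_max_0_square:
  "((\<lambda>u::real. (max 0 u)\<^sup>2) has_field_derivative 2 * max 0 u) (at u)"
proof -
  consider "u > 0" | "u < 0" | "u = 0" by linarith
  then show ?thesis
  proof cases
    case 1
    have "((\<lambda>u::real. u\<^sup>2) has_field_derivative 2 * max 0 u) (at u)"
      using 1 by (auto intro!: derivative_eq_intros)
    then show ?thesis
      by (rule DERIV_cong_ev[THEN iffD1, rotated -1, OF _ refl _ refl])
        (use 1 eventually_nhds_in_open[of "{0<..}" u] in \<open>auto elim!: eventually_mono\<close>)
  next
    case 2
    have "((\<lambda>u::real. 0) has_field_derivative 2 * max 0 u) (at u)"
      using 2 by (auto intro!: derivative_eq_intros)
    then show ?thesis
      by (rule DERIV_cong_ev[THEN iffD1, rotated -1, OF _ refl _ refl])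
        (use 2 eventually_nhds_in_open[of "{..<0}" u] in \<open>auto elim!: eventually_mono\<close>)
  next
    case 3
    have "((\<lambda>h::real. (max 0 h)\<^sup>2 / h) \<longlongrightarrow> 0) (at 0)"
    proof (rule Lim_null_comparison[OF always_eventually])
      show "\<forall>h::real. norm ((max 0 h)\<^sup>2 / h) \<le> \<bar>h\<bar>"
        by (auto simp: max_def power2_eq_square)
      show "((\<lambda>h::real. \<bar>h\<bar>) \<longlongrightarrow> 0) (at 0)"
        using tendsto_rabs[OF tendsto_ident_at[of 0 UNIV]] by simp
    qed
    then show ?thesis using 3 by (simp add: has_field_derivative_iff)
  qed
qed

text \<open>
  Translation in direction \<open>b\<close> does not change the integral of \<open>G\<close>. Differentiating under the
  integral sign at shift \<open>0\<close> therefore gives \<open>0\<close>. The box of integration is twice as large as the box that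
  contains the support, so that shifts by at most \<open>1\<close> do not move the support out of it.
\<close>

lemma integral_directional_derivative_compact_support:
  fixes G :: "'a::euclidean_space \<Rightarrow> complex"
  assumes G: "\<And>y. (G has_derivative G' y) (at y)"
    and cont: "continuous_on UNIV (\<lambda>y. G' y b)"
    and zero: "\<And>y. y \<notin> cbox (- One) One \<Longrightarrow> G y = 0"
    and b: "b \<in> Basis"
  shows "integral (cbox (- (2 *\<^sub>R One)) (2 *\<^sub>R One)) (\<lambda>y. G' y b) = 0"
proof -
  let ?Q = "cbox (- (2 *\<^sub>R One)) (2 *\<^sub>R One) :: 'a set"
  have contG: "continuous_on S G" for S
    using G by (meson continuous_at_imp_continuous_on has_derivative_continuous)
  define H where "H h = integral ?Q (\<lambda>y. G (y + h *\<^sub>R b))" for h :: real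
  have "(H has_vector_derivative integral ?Q (\<lambda>y. G' (y + 0 *\<^sub>R b) b)) (at 0 within {-1..1})"
    unfolding H_def
  proof (rule leibniz_rule_vector_derivative)
    show "((\<lambda>x. G (t + x *\<^sub>R b)) has_vector_derivative G' (t + x *\<^sub>R b) b) (at x within {- 1..1})"
      for x t
    proof -
      interpret linear "G' (t + x *\<^sub>R b)" using G by (rule has_derivative_linear)
      have "((\<lambda>x. G (t + x *\<^sub>R b)) has_derivative (\<lambda>h. G' (t + x *\<^sub>R b) (h *\<^sub>R b))) (at x within {-1..1})"
        by (rule has_derivative_compose[OF _ G]) (auto intro!: derivative_eq_intros)
      then show ?thesis by (simp add: has_vector_derivative_def scale)
    qed
    show "(\<lambda>y. G (y + x *\<^sub>R b)) integrable_on ?Q" for x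
      by (intro integrable_continuous continuous_on_compose2[OF contG[of UNIV]] continuous_intros) auto
    show "continuous_on ({- 1..1} \<times> ?Q) (\<lambda>(x, t). G' (t + x *\<^sub>R b) b)"
      unfolding split_beta
      by (intro continuous_on_compose2[OF cont] continuous_intros) auto
  qed auto
  moreover have "H h = integral (cbox (- One) One) G" if h: "h \<in> {-1..1}" for h
  proof -
    have sub: "cbox (- One) One \<subseteq> cbox (- (2 *\<^sub>R One) + h *\<^sub>R b) (2 *\<^sub>R One + h *\<^sub>R b)"
    proof -
      have "\<bar>(h *\<^sub>R b) \<bullet> i\<bar> \<le> 1" if "i \<in> Basis" for i
        using h b that by (auto simp: inner_Basis)
      then show ?thesis
        by (subst subset_box) (auto simp: inner_add_left abs_le_iff simp del: inner_scaleR_left, (force simp: inner_diff_left)+)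
    qed
    have "H h = integral (cbox (- (2 *\<^sub>R One) + h *\<^sub>R b) (2 *\<^sub>R One + h *\<^sub>R b)) G"
      unfolding H_def using integral_shift_cbox_plus[of "- (2 *\<^sub>R One)" "2 *\<^sub>R One" G "h *\<^sub>R b"]
      by (simp add: o_def add.commute)
    also have "\<dots> = integral (cbox (- (2 *\<^sub>R One) + h *\<^sub>R b) (2 *\<^sub>R One + h *\<^sub>R b))
        (\<lambda>y. if y \<in> cbox (- One) One then G y else 0)"
      using zero by (intro integral_cong) auto
    also have "\<dots> = integral (cbox (- One) One) G"
      using sub by (simp add: Henstock_Kurzweil_Integration.integral_restrict_Int inf.absorb1)
    finally show ?thesis .
  qed
  then have "(H has_vector_derivative 0) (at 0 within {-1..1})"
    by (intro has_vector_derivative_transform[of 0 "{-1..1}" H "\<lambda>_. integral (cbox (- One) One) G"]) auto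
  ultimately have "integral ?Q (\<lambda>y. G' (y + 0 *\<^sub>R b) b) = 0"
    by (intro vector_derivative_unique_within_closed_interval[of "-1" 1 0 H]) auto
  then show ?thesis by simp
qed


lemma segment_in_cube:
  assumes "e \<in> {0..r}" "y \<in> cbox (- One) One"
  shows "c + e *\<^sub>R y \<in> cube c (2 * r)"
  unfolding mem_cube
proof
  fix b :: 'a assume b: "b \<in> Basis"
  have "\<bar>y \<bullet> b\<bar> \<le> 1" using assms b by (auto simp: mem_box abs_le_iff)
  then have "e * \<bar>y \<bullet> b\<bar> \<le> r * 1" using assms by (intro mult_mono) auto
  then show "\<bar>(c + e *\<^sub>R y) \<bullet> b - c \<bullet> b\<bar> \<le> 2 * r / 2"
    using assms by (simp add: inner_add_left abs_mult)
qed

lemma cball_0_1_subset: "cball (0::'a::euclidean_space) 1 \<subseteq> cbox (- One) One"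
proof
  fix y :: 'a assume "y \<in> cball 0 1"
  then have "\<bar>y \<bullet> b\<bar> \<le> 1" if "b \<in> Basis" for b
    using Basis_le_norm[OF that, of y] by simp
  then show "y \<in> cbox (- One) One" 
    by (fastforce simp: mem_box abs_le_iff)
qed

text \<open>
  The exponent \<open>1\<close> is chosen so that \<open>bump y *\<^sub>R y\<close> is \<open>- 1 / 4\<close> times the gradient of \<open>(bump y)\<^sup>2\<close>;
  the square is continuously differentiable and vanishes off the unit ball.
\<close>

definition bump :: "'a::euclidean_space \<Rightarrow> real" where
  "bump y = max 0 (1 - y \<bullet> y)"

lemma continuous_on_bump [continuous_intros]:
  "continuous_on S f \<Longrightarrow> continuous_on S (\<lambda>x. bump (f x))"
  unfolding bump_def by (intro continuous_intros)

lemma bump_outside: "y \<notin> cball 0 1 \<Longrightarrow> bump y = 0"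
proof -
  assume "y \<notin> cball 0 1"
  then have "norm y ^ 2 > 1" by (simp add: abs_square_less_1 one_less_power)
  then show ?thesis by (simp add: bump_def dot_square_norm)
qed

lemma has_derivative_bump_square:
  "((\<lambda>y::'a::euclidean_space. (bump y)\<^sup>2) has_derivative (\<lambda>h. - (4 * bump y) * (y \<bullet> h))) (at y)"
proof -
  have "((\<lambda>y::'a. 1 - y \<bullet> y) has_derivative (\<lambda>h. - 2 * (y \<bullet> h))) (at y)"
    by (auto intro!: derivative_eq_intros simp: inner_commute)
  from has_derivative_compose[OF this has_real_derivative_max_0_square[unfolded has_field_derivative_def]]
  show ?thesis by (simp add: bump_def algebra_simps)
qed

lemma integral_bump_pos: "integral (cbox (- One) One) (bump :: 'a::euclidean_space \<Rightarrow> real) > 0"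
proof -
  let ?Q = "cbox (- One) One :: 'a set"
  have cont: "continuous_on ?Q (bump :: 'a \<Rightarrow> real)"
    by (intro continuous_on_bump continuous_on_id)
  then have int: "bump integrable_on ?Q" by (rule integrable_continuous)
  have "integral ?Q bump \<ge> 0"
    using int by (rule integral_nonneg) (simp add: bump_def)
  moreover have "integral ?Q bump \<noteq> 0"
  proof
    assume "integral ?Q bump = 0"
    then have "(bump has_integral 0) ?Q" using int by (metis integrable_integral)
    then have "bump (0::'a) = 0"
      by (intro has_integral_0_cbox_imp_0[OF cont])
        (auto simp: bump_def mem_box box_ne_empty)
    then show False by (simp add: bump_def)
  qed
  ultimately show ?thesis by simp
qed

text \<open>
  The integrand is the derivative of \<open>bump y *\<^sub>R f (c + e *\<^sub>R y)\<close> with respect to \<open>e\<close>. For each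
  coordinate an integration by parts moves the derivative from \<open>(bump y)\<^sup>2\<close> to the partial
  derivative of \<open>f\<close>, and the sum over the coordinates is the integral of \<open>(bump y)\<^sup>2\<close> against the
  Laplacian of \<open>f\<close>.
\<close>

lemma integral_bump_radial_derivative:
  fixes f :: "'a::euclidean_space \<Rightarrow> complex"
  assumes "open \<Omega>" and f: "harmonic_on \<Omega> f" and sub: "cube c (2 * r) \<subseteq> \<Omega>" and e: "e \<in> {0..r}"
  shows "integral (cbox (- One) One)
    (\<lambda>y. bump y *\<^sub>R (\<Sum>b\<in>Basis. (y \<bullet> b) *\<^sub>R dir_deriv b f (c + e *\<^sub>R y))) = 0"
proof -
  let ?Q = "cbox (- One) One :: 'a set"
  let ?A = "\<lambda>b y. (bump y * (y \<bullet> b)) *\<^sub>R dir_deriv b f (c + e *\<^sub>R y)"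
  let ?B = "\<lambda>b y. (bump y)\<^sup>2 *\<^sub>R dir_deriv b (dir_deriv b f) (c + e *\<^sub>R y)"
  define U where "U = (\<lambda>y. c + e *\<^sub>R y) -` \<Omega>"
  have U: "open U" unfolding U_def
    by (intro continuous_open_vimage \<open>open \<Omega>\<close> continuous_intros)
  have QU: "?Q \<subseteq> U" using segment_in_cube[OF e] sub by (auto simp: U_def)
  have out: "bump y = 0" if "y \<notin> ?Q" for y :: 'a
    using that bump_outside cball_0_1_subset by blast
  have cover: "U \<union> - cball 0 1 = UNIV" using QU cball_0_1_subset by blast
  have contD: "continuous_on U (\<lambda>y. dir_deriv b f (c + e *\<^sub>R y))"
     "continuous_on U (\<lambda>y. dir_deriv b (dir_deriv b f) (c + e *\<^sub>R y))" if b: "b \<in> Basis" for b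
  proof -
    have 1: "continuous_on \<Omega> (dir_deriv b f)"
      using f b by (rule harmonic_on_imp_continuous_on_dir_deriv)
    have 2: "continuous_on \<Omega> (dir_deriv b (dir_deriv b f))"
      using f b by (simp add: harmonic_on_def C2_on_def)
    have 3: "continuous_on U (\<lambda>y. c + e *\<^sub>R y)" "(\<lambda>y. c + e *\<^sub>R y) ` U \<subseteq> \<Omega>"
      by (auto intro!: continuous_intros simp: U_def)
    show "continuous_on U (\<lambda>y. dir_deriv b f (c + e *\<^sub>R y))"
      "continuous_on U (\<lambda>y. dir_deriv b (dir_deriv b f) (c + e *\<^sub>R y))"
      using continuous_on_compose2[OF 1 3] continuous_on_compose2[OF 2 3] by auto
  qed
  have contA: "continuous_on ?Q (?A b)" and contB: "continuous_on ?Q (?B b)" if b: "b \<in> Basis" for b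
    using contD[OF b, THEN continuous_on_subset, OF QU] by (auto intro!: continuous_intros)
  have parts: "integral ?Q (?A b) = (e / 4) *\<^sub>R integral ?Q (?B b)" if b: "b \<in> Basis" for b
  proof -
    \<comment> \<open>The product, extended by 0, is differentiable everywhere: it agrees with a differentiable
      product near the box and with 0 off the unit ball, and these open sets cover the space.\<close>
    define G where "G y = (if y \<in> ?Q then (bump y)\<^sup>2 *\<^sub>R dir_deriv b f (c + e *\<^sub>R y) else 0)" for y
    define G' where "G' y h = (if y \<in> ?Q then (- (4 * bump y) * (y \<bullet> h)) *\<^sub>R dir_deriv b f (c + e *\<^sub>R y)
        + (bump y)\<^sup>2 *\<^sub>R (\<Sum>b'\<in>Basis. (e * (h \<bullet> b')) *\<^sub>R dir_deriv b' (dir_deriv b f) (c + e *\<^sub>R y))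
        else 0)" for y h
    have G'b: "G' y b = (if y \<in> ?Q then (-4) *\<^sub>R ?A b y + e *\<^sub>R ?B b y else 0)" for y
    proof -
      have "(\<Sum>b'\<in>Basis. (e * (b \<bullet> b')) *\<^sub>R dir_deriv b' (dir_deriv b f) (c + e *\<^sub>R y))
        = e *\<^sub>R dir_deriv b (dir_deriv b f) (c + e *\<^sub>R y)"
        by (simp add: sum_inner_Basis_scaleR b flip: scaleR_scaleR scaleR_sum_right)
      then show ?thesis using b by (simp add: G'_def mult_ac)
    qed
    have "(G has_derivative G' y) (at y)" for y
    proof (cases "y \<in> U")
      case True
      let ?D = "\<lambda>h. (- (4 * bump y) * (y \<bullet> h)) *\<^sub>R dir_deriv b f (c + e *\<^sub>R y)
        + (bump y)\<^sup>2 *\<^sub>R (\<Sum>b'\<in>Basis. (e * (h \<bullet> b')) *\<^sub>R dir_deriv b' (dir_deriv b f) (c + e *\<^sub>R y))"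
      have "dir_deriv b f differentiable (at (c + e *\<^sub>R y))"
        using True f b by (auto simp: U_def harmonic_on_def C2_on_def)
      then have D: "(dir_deriv b f has_derivative
          (\<lambda>h. \<Sum>b'\<in>Basis. (h \<bullet> b') *\<^sub>R dir_deriv b' (dir_deriv b f) (c + e *\<^sub>R y))) (at (c + e *\<^sub>R y))"
        by (rule has_derivative_dir_deriv)
      have "((\<lambda>y. c + e *\<^sub>R y) has_derivative (\<lambda>h. e *\<^sub>R h)) (at y)"
        by (auto intro!: derivative_eq_intros)
      from has_derivative_scaleR[OF has_derivative_bump_square has_derivative_compose[OF this D]]
      have "((\<lambda>y. (bump y)\<^sup>2 *\<^sub>R dir_deriv b f (c + e *\<^sub>R y)) has_derivative ?D) (at y)"
        by (simp add: add.commute)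
      then have "(G has_derivative ?D) (at y)"
        by (rule has_derivative_transform_within_open[OF _ U True]) (auto simp: G_def out)
      moreover have "?D = G' y" by (auto simp: G'_def out fun_eq_iff)
      ultimately show ?thesis by simp
    next
      case False
      then have y: "y \<in> - cball 0 1" using cover by blast
      have "(G has_derivative (\<lambda>h. 0)) (at y)"
        by (rule has_derivative_transform_within_open[OF has_derivative_const[of 0] _ y])
          (auto simp: G_def bump_outside)
      moreover have "G' y = (\<lambda>h. 0)" using False QU unfolding G'_def by fastforce
      ultimately show ?thesis by simp
    qed
    moreover have "continuous_on UNIV (\<lambda>y. G' y b)"
      unfolding cover[symmetric]
    proof (rule continuous_on_open_Un)
      have "continuous_on U (\<lambda>y. (-4) *\<^sub>R ?A b y + e *\<^sub>R ?B b y)"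
        using contD[OF b] by (auto intro!: continuous_intros)
      then show "continuous_on U (\<lambda>y. G' y b)"
        by (rule continuous_on_cong[THEN iffD1, OF refl, rotated]) (auto simp: G'b out)
      show "continuous_on (- cball 0 1) (\<lambda>y. G' y b)"
        by (rule continuous_on_cong[THEN iffD1, OF refl _ continuous_on_const[of _ 0]])
          (auto simp: G'b bump_outside)
    qed (use U in auto)
    ultimately have "integral (cbox (- (2 *\<^sub>R One)) (2 *\<^sub>R One)) (\<lambda>y. G' y b) = 0"
      using b by (intro integral_directional_derivative_compact_support[where G=G]) (auto simp: G_def)
    moreover have "?Q \<subseteq> cbox (- (2 *\<^sub>R One)) (2 *\<^sub>R One)"
      by (subst subset_box) auto
    ultimately have "integral ?Q (\<lambda>y. (-4) *\<^sub>R ?A b y + e *\<^sub>R ?B b y) = 0"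
      unfolding G'b by (simp add: Henstock_Kurzweil_Integration.integral_restrict_Int inf.absorb1)
    also have "integral ?Q (\<lambda>y. (-4) *\<^sub>R ?A b y + e *\<^sub>R ?B b y)
        = (-4) *\<^sub>R integral ?Q (?A b) + e *\<^sub>R integral ?Q (?B b)"
      by (intro integral_unique has_integral_add has_integral_cmul integrable_integral
          integrable_continuous contA[OF b] contB[OF b])
    finally show ?thesis by (simp add: scaleR_conv_of_real field_simps)
  qed
  have "integral ?Q (\<lambda>y. bump y *\<^sub>R (\<Sum>b\<in>Basis. (y \<bullet> b) *\<^sub>R dir_deriv b f (c + e *\<^sub>R y)))
      = integral ?Q (\<lambda>y. \<Sum>b\<in>Basis. ?A b y)"
    by (simp add: scaleR_sum_right)
  also have "\<dots> = (\<Sum>b\<in>Basis. integral ?Q (?A b))"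
    by (rule integral_sum) (auto intro!: integrable_continuous contA)
  also have "\<dots> = (e / 4) *\<^sub>R (\<Sum>b\<in>Basis. integral ?Q (?B b))"
    by (simp add: parts scaleR_sum_right)
  also have "(\<Sum>b\<in>Basis. integral ?Q (?B b)) = integral ?Q (\<lambda>y. \<Sum>b\<in>Basis. ?B b y)"
    by (rule integral_sum[symmetric]) (auto intro!: integrable_continuous contB)
  also have "\<dots> = integral ?Q (\<lambda>y. 0)"
  proof (rule integral_cong)
    fix y assume "y \<in> ?Q"
    then have "laplacian f (c + e *\<^sub>R y) = 0"
      using QU f by (auto simp: U_def harmonic_on_def)
    then show "(\<Sum>b\<in>Basis. ?B b y) = 0"
      by (simp add: laplacian_def flip: scaleR_sum_right)
  qed
  finally show ?thesis by simp
qed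

text \<open>
  The left-hand side does not depend on \<open>r\<close>, by the preceding lemma, and the right-hand side is its
  value for \<open>r = 0\<close>.
\<close>

lemma mean_value_bump:
  fixes f :: "'a::euclidean_space \<Rightarrow> complex"
  assumes "open \<Omega>" and f: "harmonic_on \<Omega> f" and sub: "cube c (2 * r) \<subseteq> \<Omega>" and r: "r \<ge> 0"
  shows "integral (cbox (- One) One) (\<lambda>y. bump y *\<^sub>R f (c + r *\<^sub>R y))
    = integral (cbox (- One) One) (bump :: 'a \<Rightarrow> real) *\<^sub>R f c"
proof -
  let ?Q = "cbox (- One) One :: 'a set"
  define F where "F e = integral ?Q (\<lambda>y. bump y *\<^sub>R f (c + e *\<^sub>R y))" for e
  have in\<Omega>: "c + e *\<^sub>R y \<in> \<Omega>" if "e \<in> {0..r}" "y \<in> ?Q" for e y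
    using segment_in_cube[OF that] sub by auto
  note contf = harmonic_on_imp_continuous_on[OF f]
  have "(F has_vector_derivative 0) (at e within {0..r})" if e: "e \<in> {0..r}" for e
  proof -
    have "(F has_vector_derivative integral ?Q
        (\<lambda>y. bump y *\<^sub>R (\<Sum>b\<in>Basis. (y \<bullet> b) *\<^sub>R dir_deriv b f (c + e *\<^sub>R y)))) (at e within {0..r})"
      unfolding F_def
    proof (rule leibniz_rule_vector_derivative)
      fix e y assume ey: "e \<in> {0..r}" "y \<in> ?Q"
      have "((\<lambda>e. c + e *\<^sub>R y) has_derivative (\<lambda>h. h *\<^sub>R y)) (at e within {0..r})"
        by (auto intro!: derivative_eq_intros)
      moreover have "(f has_derivative (\<lambda>h. \<Sum>b\<in>Basis. (h \<bullet> b) *\<^sub>R dir_deriv b f (c + e *\<^sub>R y))) (at (c + e *\<^sub>R y))"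
        using in\<Omega>[OF ey] f by (intro has_derivative_dir_deriv) (auto simp: harmonic_on_def C2_on_def)
      ultimately have "((\<lambda>e. f (c + e *\<^sub>R y)) has_derivative
          (\<lambda>h. \<Sum>b\<in>Basis. (h *\<^sub>R y \<bullet> b) *\<^sub>R dir_deriv b f (c + e *\<^sub>R y))) (at e within {0..r})"
        by (rule has_derivative_compose)
      then show "((\<lambda>e. bump y *\<^sub>R f (c + e *\<^sub>R y)) has_vector_derivative
          bump y *\<^sub>R (\<Sum>b\<in>Basis. (y \<bullet> b) *\<^sub>R dir_deriv b f (c + e *\<^sub>R y))) (at e within {0..r})"
        unfolding has_vector_derivative_def
        by (intro has_derivative_eq_rhs[OF has_derivative_scaleR_right])
          (auto simp: scaleR_sum_right mult_ac)
    next
      fix e assume "e \<in> {0..r}"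
      then show "(\<lambda>y. bump y *\<^sub>R f (c + e *\<^sub>R y)) integrable_on ?Q"
        by (intro integrable_continuous continuous_intros continuous_on_compose2[OF contf])
          (auto simp: in\<Omega>)
    next
      show "continuous_on ({0..r} \<times> ?Q)
          (\<lambda>(e, y). bump y *\<^sub>R (\<Sum>b\<in>Basis. (y \<bullet> b) *\<^sub>R dir_deriv b f (c + e *\<^sub>R y)))"
        unfolding split_beta
        by (intro continuous_intros continuous_on_compose2[OF harmonic_on_imp_continuous_on_dir_deriv[OF f]])
          (auto simp: in\<Omega>)
    qed (use e in auto)
    then show ?thesis
      by (simp add: integral_bump_radial_derivative[OF assms(1-3) e])
  qed
  then have "\<exists>k. \<forall>e\<in>{0..r}. F e = k"
    by (intro has_derivative_zero_constant) (auto simp: has_vector_derivative_def)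
  then have "F r = F 0" using r by auto
  also have "F 0 = integral ?Q (\<lambda>y. bump y *\<^sub>R f c)" by (simp add: F_def)
  also have "\<dots> = integral ?Q bump *\<^sub>R f c"
  proof (rule integral_unique)
    have "(bump has_integral integral ?Q bump) ?Q"
      by (intro integrable_integral integrable_continuous continuous_on_bump continuous_on_id)
    then show "((\<lambda>y. bump y *\<^sub>R f c) has_integral integral ?Q bump *\<^sub>R f c) ?Q"
      by (rule has_integral_scaleR_left)
  qed
  finally show ?thesis by (simp add: F_def)
qed

section \<open>Pointwise bounds for harmonic functions by averages of powers\<close>

lemma cube_subset_cball:
  fixes c :: "'a::euclidean_space"
  assumes "r \<ge> 0"
  shows "cube c (2 * r) \<subseteq> cball c (real DIM('a) * r)"
proof
  fix x assume x: "x \<in> cube c (2 * r)"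
  have "norm (x - c) \<le> (\<Sum>b\<in>Basis. \<bar>(x - c) \<bullet> b\<bar>)" by (rule norm_le_l1)
  also have "\<dots> \<le> (\<Sum>b\<in>(Basis::'a set). r)"
    using x by (intro sum_mono) (auto simp: mem_cube inner_diff_left)
  finally show "x \<in> cball c (real DIM('a) * r)" by (simp add: dist_norm norm_minus_commute)
qed

lemma cball_subset_cube: "cball c r \<subseteq> cube c (2 * r)"
proof
  fix x assume x: "x \<in> cball c r"
  have "\<bar>x \<bullet> b - c \<bullet> b\<bar> \<le> r" if "b \<in> Basis" for b
    using Basis_le_norm[OF that, of "x - c"] x by (simp add: inner_diff_left dist_norm norm_minus_commute)
  then show "x \<in> cube c (2 * r)" by (simp add: mem_cube)
qed

lemma norm_le_cube_average:
  "\<exists>K>0. \<forall>(f :: 'a::euclidean_space \<Rightarrow> complex) \<Omega> c r. open \<Omega> \<longrightarrow> harmonic_on \<Omega> f \<longrightarrow> r > 0 \<longrightarrow> cube c (2 * r) \<subseteq> \<Omega> \<longrightarrow>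
     norm (f c) \<le> K / r ^ DIM('a) * integral (cube c (2 * r)) (\<lambda>x. norm (f x))"
proof (intro exI[of _ "1 / integral (cbox (- One) One) (bump :: 'a \<Rightarrow> real)"] conjI allI impI)
  let ?Q = "cbox (- One) One :: 'a set"
  let ?J = "integral ?Q bump"
  show "1 / ?J > 0" using integral_bump_pos by simp
  fix f :: "'a \<Rightarrow> complex" and \<Omega> :: "'a set" and c :: 'a and r :: real
  assume \<Omega>: "open \<Omega>" and f: "harmonic_on \<Omega> f" and r: "r > 0" and sub: "cube c (2 * r) \<subseteq> \<Omega>"
  let ?I = "integral (cube c (2 * r)) (\<lambda>x. norm (f x))"
  have contf: "continuous_on \<Omega> f" using f by (rule harmonic_on_imp_continuous_on)
  have in\<Omega>: "c + r *\<^sub>R y \<in> \<Omega>" if "y \<in> ?Q" for y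
    using segment_in_cube[of r r y c] that r sub by auto
  have contfy: "continuous_on ?Q (\<lambda>y. f (c + r *\<^sub>R y))"
    by (intro continuous_intros continuous_on_compose2[OF contf]) (auto simp: in\<Omega>)
  have "((\<lambda>x. norm (f x)) has_integral ?I) (cube c (2 * r))"
    using continuous_on_subset[OF contf sub]
    by (intro integrable_integral) (auto simp: cube_def intro!: integrable_continuous continuous_intros)
  then have "((\<lambda>y. norm (f (r *\<^sub>R y + c))) has_integral (?I /\<^sub>R r ^ DIM('a)))
      (cbox ((c - r *\<^sub>R One - c) /\<^sub>R r) ((c + r *\<^sub>R One - c) /\<^sub>R r))"
    using r by (intro has_integral_affinity') (auto simp: cube_def)
  then have int: "((\<lambda>y. norm (f (c + r *\<^sub>R y))) has_integral (?I / r ^ DIM('a))) ?Q"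
    using r by (simp add: add.commute divide_inverse mult.commute)
  have "?J * norm (f c) = norm (integral ?Q (\<lambda>y. bump y *\<^sub>R f (c + r *\<^sub>R y)))"
    using integral_bump_pos[where 'a='a] r by (subst mean_value_bump[OF \<Omega> f sub]) auto
  also have "\<dots> \<le> integral ?Q (\<lambda>y. norm (f (c + r *\<^sub>R y)))"
  proof (rule integral_norm_bound_integral)
    show "(\<lambda>y. bump y *\<^sub>R f (c + r *\<^sub>R y)) integrable_on ?Q"
      by (intro integrable_continuous continuous_intros contfy)
    show "(\<lambda>y. norm (f (c + r *\<^sub>R y))) integrable_on ?Q"
      using int by blast
    show "norm (bump y *\<^sub>R f (c + r *\<^sub>R y)) \<le> norm (f (c + r *\<^sub>R y))" for y
      by (simp add: bump_def mult_left_le_one_le)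
  qed
  also have "\<dots> = ?I / r ^ DIM('a)" using int by (rule integral_unique)
  finally show "norm (f c) \<le> 1 / ?J / r ^ DIM('a) * ?I"
    using integral_bump_pos[where 'a='a] r by (simp add: pos_le_divide_eq mult_ac)
qed

lemma harmonic_powr_integrable_on_cube:
  assumes "harmonic_on \<Omega> f" "cube c l \<subseteq> \<Omega>" "p > 0"
  shows "(\<lambda>x. norm (f x) powr p) integrable_on cube c l"
  unfolding cube_def
  using assms(3) continuous_on_subset[OF harmonic_on_imp_continuous_on[OF assms(1)] assms(2)]
  by (intro integrable_continuous continuous_on_powr' continuous_intros) (auto simp: cube_def)

lemma harmonic_norm_integrable_on_cube:
  assumes "harmonic_on \<Omega> f" "cube c l \<subseteq> \<Omega>"
  shows "(\<lambda>x. norm (f x)) integrable_on cube c l"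
  using harmonic_powr_integrable_on_cube[OF assms, of 1] by simp

lemma content_cube: "l \<ge> 0 \<Longrightarrow> measure lborel (cube (c::'a::euclidean_space) l) = l ^ DIM('a)"
  unfolding cube_def
  by (subst content_cbox) (auto simp: inner_diff_left inner_add_left)

text \<open>
  For \<open>p \<ge> 1\<close> and \<open>L > 0\<close> the inequality \<open>u \<le> L powr (1 - p) * u powr p + L\<close> bounds the average of
  \<open>|f|\<close>. The last term contributes a multiple of \<open>L\<close>, and \<open>L\<close> is chosen so that this multiple is
  half of the value at the centre, where it can be absorbed.
\<close>

lemma norm_powr_le_cube_average_ge_1:
  assumes p: "p \<ge> 1"
  shows "\<exists>K>0. \<forall>(f :: 'a::euclidean_space \<Rightarrow> complex) \<Omega> c r. open \<Omega> \<longrightarrow> harmonic_on \<Omega> f \<longrightarrow> r > 0 \<longrightarrow> cube c (2 * r) \<subseteq> \<Omega> \<longrightarrow>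
     norm (f c) powr p \<le> K / r ^ DIM('a) * integral (cube c (2 * r)) (\<lambda>x. norm (f x) powr p)"
proof -
  let ?N = "DIM('a)"
  obtain K where K: "K > 0" and avg: "\<And>(f :: 'a \<Rightarrow> complex) \<Omega> c r. open \<Omega> \<Longrightarrow> harmonic_on \<Omega> f \<Longrightarrow> r > 0 \<Longrightarrow> cube c (2 * r) \<subseteq> \<Omega> \<Longrightarrow>
     norm (f c) \<le> K / r ^ ?N * integral (cube c (2 * r)) (\<lambda>x. norm (f x))"
    using norm_le_cube_average by blast
  define B where "B = K * 2 ^ (?N + 1)"
  have B: "B > 0" using K by (simp add: B_def)
  show ?thesis
  proof (intro exI[of _ "2 * K * B powr (p - 1)"] conjI allI impI)
    show "2 * K * B powr (p - 1) > 0" using K B by simp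
    fix f :: "'a \<Rightarrow> complex" and \<Omega> :: "'a set" and c :: 'a and r :: real
    assume \<Omega>: "open \<Omega>" and f: "harmonic_on \<Omega> f" and r: "r > 0" and sub: "cube c (2 * r) \<subseteq> \<Omega>"
    let ?I = "integral (cube c (2 * r)) (\<lambda>x. norm (f x) powr p)"
    define M where "M = norm (f c)"
    have intp: "(\<lambda>x. norm (f x) powr p) integrable_on cube c (2 * r)"
      using harmonic_powr_integrable_on_cube[OF f sub] p by simp
    have "M powr p \<le> 2 * K * B powr (p - 1) / r ^ ?N * ?I"
    proof (cases "M = 0")
      case True
      then show ?thesis using K B r integral_nonneg[OF intp] by simp
    next
      case False
      then have M: "M > 0" by (simp add: M_def)
      define L where "L = M / B"
      have L: "L > 0" using M B by (simp add: L_def)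
      have pointwise: "u \<le> L powr (1 - p) * u powr p + L" if "u \<ge> 0" for u :: real
      proof (cases "u \<le> L")
        case False
        have "u = u powr (1 - p) * u powr p" using False L by (simp flip: powr_add)
        also have "\<dots> \<le> L powr (1 - p) * u powr p"
          using False L p by (intro mult_right_mono powr_mono2') auto
        finally show ?thesis using L by simp
      next
        case True
        then show ?thesis by (simp add: add_increasing)
      qed
      have const: "((\<lambda>x. L) has_integral L * (2 * r) ^ ?N) (cube c (2 * r))"
        using has_integral_const[of L "c - r *\<^sub>R One" "c + r *\<^sub>R One"] content_cube[of "2 * r" c] r
        by (simp add: cube_def mult.commute)
      have "integral (cube c (2 * r)) (\<lambda>x. norm (f x)) \<le> L powr (1 - p) * ?I + L * (2 * r) ^ ?N"
      proof (rule has_integral_le)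
        show "((\<lambda>x. norm (f x)) has_integral integral (cube c (2 * r)) (\<lambda>x. norm (f x))) (cube c (2 * r))"
          using harmonic_norm_integrable_on_cube[OF f sub] by (rule integrable_integral)
        show "((\<lambda>x. L powr (1 - p) * norm (f x) powr p + L) has_integral L powr (1 - p) * ?I + L * (2 * r) ^ ?N)
            (cube c (2 * r))"
          by (intro has_integral_add const has_integral_mult_right integrable_integral intp)
      qed (auto intro: pointwise)
      then have "M \<le> K / r ^ ?N * (L powr (1 - p) * ?I + L * (2 * r) ^ ?N)"
        using avg[OF \<Omega> f r sub] K r unfolding M_def by (smt (verit) divide_pos_pos mult_left_mono zero_less_power)
      also have "\<dots> = K / r ^ ?N * L powr (1 - p) * ?I + M / 2"
        using K r by (simp add: L_def B_def field_simps)
      finally have "M / 2 \<le> K / r ^ ?N * L powr (1 - p) * ?I" by linarith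
      then have "M powr (p - 1) * (M / 2) \<le> M powr (p - 1) * (K / r ^ ?N * L powr (1 - p) * ?I)"
        by (rule mult_left_mono) simp
      also have "M powr (p - 1) * (M / 2) = M powr p / 2"
        using M by (simp add: powr_diff)
      also have "L powr (1 - p) = M powr (1 - p) * B powr (p - 1)"
        using M B by (simp add: L_def powr_divide powr_diff divide_simps)
      also have "M powr (p - 1) * (K / r ^ ?N * (M powr (1 - p) * B powr (p - 1)) * ?I)
          = (M powr (p - 1) * M powr (1 - p)) * (K / r ^ ?N * B powr (p - 1) * ?I)"
        by (simp add: mult_ac)
      also have "M powr (p - 1) * M powr (1 - p) = 1" using M by (simp flip: powr_add)
      finally show ?thesis by (simp add: mult_ac)
    qed
    then show "norm (f c) powr p \<le> 2 * K * B powr (p - 1) / r ^ ?N * ?I"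
      by (simp add: M_def)
  qed
qed

text \<open>
  The argument is that of Hardy and Littlewood. Let \<open>x0\<close> maximise \<open>|f x| * d(x)^(DIM / p)\<close>, where
  \<open>d\<close> is the distance to the sphere of radius \<open>r\<close>. On a cube around \<open>x0\<close> whose size is a multiple of
  \<open>d(x0)\<close>, maximality bounds \<open>|f|\<close> by a multiple of \<open>|f x0|\<close>, hence \<open>|f|\<close> by a multiple of
  \<open>|f x0|^(1 - p) * |f|^p\<close>. The case \<open>p = 1\<close> at \<open>x0\<close> then bounds the maximum, and so the value at \<open>c\<close>.
\<close>

lemma norm_powr_le_cube_average_less_1:
  assumes p: "0 < p" "p < 1"
  shows "\<exists>K>0. \<forall>(f :: 'a::euclidean_space \<Rightarrow> complex) \<Omega> c r. open \<Omega> \<longrightarrow> harmonic_on \<Omega> f \<longrightarrow> r > 0 \<longrightarrow> cube c (2 * r) \<subseteq> \<Omega> \<longrightarrow>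
     norm (f c) powr p \<le> K / r ^ DIM('a) * integral (cube c (2 * r)) (\<lambda>x. norm (f x) powr p)"
proof -
  let ?N = "DIM('a)"
  obtain K where K: "K > 0" and avg: "\<And>(f :: 'a \<Rightarrow> complex) \<Omega> c r. open \<Omega> \<Longrightarrow> harmonic_on \<Omega> f \<Longrightarrow> r > 0 \<Longrightarrow> cube c (2 * r) \<subseteq> \<Omega> \<Longrightarrow>
     norm (f c) \<le> K / r ^ ?N * integral (cube c (2 * r)) (\<lambda>x. norm (f x))"
    using norm_le_cube_average by blast
  define q where "q = real ?N / p"
  have q: "q > 0" using p by (simp add: q_def)
  define K' where "K' = K * (2 * real ?N) ^ ?N * (2 powr q) powr (1 - p)"
  show ?thesis
  proof (intro exI[of _ K'] conjI allI impI)
    show "K' > 0" using K by (simp add: K'_def)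
    fix f :: "'a \<Rightarrow> complex" and \<Omega> :: "'a set" and c :: 'a and r :: real
    assume \<Omega>: "open \<Omega>" and f: "harmonic_on \<Omega> f" and r: "r > 0" and sub: "cube c (2 * r) \<subseteq> \<Omega>"
    let ?I = "\<lambda>S. integral S (\<lambda>x. norm (f x) powr p)"
    define h where "h x = norm (f x) * (r - dist c x) powr q" for x
    have contf: "continuous_on (cball c r) f"
      using continuous_on_subset[OF harmonic_on_imp_continuous_on[OF f]] sub cball_subset_cube by blast
    have "continuous_on (cball c r) h"
      unfolding h_def using q by (intro continuous_on_powr' continuous_intros contf) auto
    then obtain x0 where x0: "x0 \<in> cball c r" and max: "\<And>y. y \<in> cball c r \<Longrightarrow> h y \<le> h x0"
      using continuous_attains_sup[of "cball c r" h] r by auto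
    define d where "d = r - dist c x0"
    define M where "M = norm (f x0)"
    have d0: "d \<ge> 0" using x0 by (simp add: d_def)
    have hx0: "h x0 = M * d powr q" by (simp add: h_def M_def d_def)
    \<comment> \<open>The function \<open>h\<close> compares the centre, where the distance is \<open>r\<close>, with the maximum point.\<close>
    have hc: "norm (f c) * r powr q \<le> M * d powr q"
      using max[of c] r hx0 by (simp add: h_def)
    have key: "M powr p * d ^ ?N \<le> K' * ?I (cube c (2 * r))"
    proof (cases "M = 0 \<or> d = 0")
      case True
      have "?I (cube c (2 * r)) \<ge> 0"
        using harmonic_powr_integrable_on_cube[OF f sub p(1)] by (rule integral_nonneg) simp
      then show ?thesis using True \<open>K' > 0\<close> p by (auto simp: power_0_left)
    next
      case False
      then have M: "M > 0" and d: "d > 0" using d0 by (auto simp: M_def)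
      \<comment> \<open>The cube of half-side \<open>\<rho>\<close> around \<open>x0\<close> lies in the ball of radius \<open>d / 2\<close>.\<close>
      define \<rho> where "\<rho> = d / (2 * real ?N)"
      have \<rho>: "\<rho> > 0" using d by (simp add: \<rho>_def)
      have in_ball: "y \<in> cball x0 (d / 2)" if "y \<in> cube x0 (2 * \<rho>)" for y
        using cube_subset_cball[of \<rho> x0] that \<rho> by (auto simp: \<rho>_def)
      have far: "r - dist c y \<ge> d / 2" if "y \<in> cube x0 (2 * \<rho>)" for y
        using in_ball[OF that] dist_triangle[of c y x0] by (simp add: d_def)
      have cube_sub: "cube x0 (2 * \<rho>) \<subseteq> cube c (2 * r)"
        using far d cball_subset_cube[of c r] by force
      define T where "T = M * 2 powr q"
      have T: "T > 0" using M by (simp add: T_def)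
      have bound: "norm (f y) \<le> T" if y: "y \<in> cube x0 (2 * \<rho>)" for y
      proof -
        have "norm (f y) * (d / 2) powr q \<le> norm (f y) * (r - dist c y) powr q"
          using far[OF y] d q by (intro mult_left_mono powr_mono2) auto
        also have "\<dots> \<le> M * d powr q"
          using max[of y] far[OF y] d unfolding hx0 by (simp add: h_def)
        finally show ?thesis using d by (simp add: T_def powr_divide field_simps)
      qed
      have "M \<le> K / \<rho> ^ ?N * integral (cube x0 (2 * \<rho>)) (\<lambda>x. norm (f x))"
        unfolding M_def using cube_sub sub by (intro avg[OF \<Omega> f \<rho>]) auto
      also have "\<dots> \<le> K / \<rho> ^ ?N * integral (cube x0 (2 * \<rho>)) (\<lambda>x. T powr (1 - p) * norm (f x) powr p)"
      proof (intro mult_left_mono integral_le)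
        fix y assume y: "y \<in> cube x0 (2 * \<rho>)"
        have "norm (f y) = norm (f y) powr (1 - p) * norm (f y) powr p"
          by (cases "norm (f y) = 0") (simp_all flip: powr_add)
        also have "\<dots> \<le> T powr (1 - p) * norm (f y) powr p"
          using bound[OF y] p by (intro mult_right_mono powr_mono2) auto
        finally show "norm (f y) \<le> T powr (1 - p) * norm (f y) powr p" .
      next
        show "(\<lambda>x. norm (f x)) integrable_on cube x0 (2 * \<rho>)"
          using harmonic_norm_integrable_on_cube[OF f] cube_sub sub by blast
        show "(\<lambda>x. T powr (1 - p) * norm (f x) powr p) integrable_on cube x0 (2 * \<rho>)"
          using harmonic_powr_integrable_on_cube[OF f _ p(1)] cube_sub sub
          by (intro integrable_on_mult_right) blast
      qed (use K \<rho> in auto)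
      also have "\<dots> = K / \<rho> ^ ?N * T powr (1 - p) * ?I (cube x0 (2 * \<rho>))"
        by simp
      also have "\<dots> \<le> K / \<rho> ^ ?N * T powr (1 - p) * ?I (cube c (2 * r))"
        using harmonic_powr_integrable_on_cube[OF f _ p(1)] cube_sub sub K \<rho>
        by (intro mult_left_mono integral_subset_le) auto
      also have "\<dots> = K' / d ^ ?N * M powr (1 - p) * ?I (cube c (2 * r))"
        using M by (simp add: K'_def T_def \<rho>_def powr_mult power_divide)
      finally have "M * M powr (p - 1) \<le> K' / d ^ ?N * M powr (1 - p) * ?I (cube c (2 * r)) * M powr (p - 1)"
        by (rule mult_right_mono) simp
      also have "M * M powr (p - 1) = M powr p" using M by (simp add: powr_diff)
      also have "K' / d ^ ?N * M powr (1 - p) * ?I (cube c (2 * r)) * M powr (p - 1)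
          = K' / d ^ ?N * ?I (cube c (2 * r)) * (M powr (1 - p) * M powr (p - 1))"
        by (simp add: mult_ac)
      also have "M powr (1 - p) * M powr (p - 1) = 1" using M by (simp flip: powr_add)
      finally show ?thesis using d by (simp add: field_simps)
    qed
    have qp: "(x powr q) powr p = x ^ ?N" if "x \<ge> 0" for x
      using that p by (cases "x = 0") (simp_all add: powr_powr q_def powr_realpow)
    have "(norm (f c) * r powr q) powr p \<le> (M * d powr q) powr p"
      using hc p by (intro powr_mono2) auto
    then have "norm (f c) powr p * r ^ ?N \<le> M powr p * d ^ ?N"
      using r d0 by (simp add: powr_mult qp M_def)
    with key have "norm (f c) powr p * r ^ ?N \<le> K' * ?I (cube c (2 * r))" by linarith
    then show "norm (f c) powr p \<le> K' / r ^ ?N * ?I (cube c (2 * r))"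
      using r by (simp add: field_simps)
  qed
qed

lemma norm_powr_le_cube_average:
  assumes p: "p > 0"
  obtains K where "K > 0"
    and "\<And>(f :: 'a::euclidean_space \<Rightarrow> complex) \<Omega> c r. open \<Omega> \<Longrightarrow> harmonic_on \<Omega> f \<Longrightarrow> r > 0 \<Longrightarrow> cube c (2 * r) \<subseteq> \<Omega> \<Longrightarrow>
     ennreal (norm (f c) powr p)
       \<le> ennreal (K / r ^ DIM('a)) * (\<integral>\<^sup>+x\<in>cube c (2 * r). ennreal (norm (f x) powr p) \<partial>lborel)"
proof -
  have "\<exists>K>0. \<forall>(f :: 'a \<Rightarrow> complex) \<Omega> c r. open \<Omega> \<longrightarrow> harmonic_on \<Omega> f \<longrightarrow> r > 0 \<longrightarrow> cube c (2 * r) \<subseteq> \<Omega> \<longrightarrow>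
     norm (f c) powr p \<le> K / r ^ DIM('a) * integral (cube c (2 * r)) (\<lambda>x. norm (f x) powr p)"
    using norm_powr_le_cube_average_ge_1[of p] norm_powr_le_cube_average_less_1[of p] p
    by (cases "p \<ge> 1") simp_all
  then obtain K where K: "K > 0" and avg: "\<And>(f :: 'a \<Rightarrow> complex) \<Omega> c r. open \<Omega> \<Longrightarrow> harmonic_on \<Omega> f \<Longrightarrow> r > 0 \<Longrightarrow> cube c (2 * r) \<subseteq> \<Omega> \<Longrightarrow>
     norm (f c) powr p \<le> K / r ^ DIM('a) * integral (cube c (2 * r)) (\<lambda>x. norm (f x) powr p)"
    by blast
  show ?thesis
  proof (rule that[OF K])
    fix f :: "'a \<Rightarrow> complex" and \<Omega> :: "'a set" and c :: 'a and r :: real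
    assume \<Omega>: "open \<Omega>" and f: "harmonic_on \<Omega> f" and r: "r > 0" and sub: "cube c (2 * r) \<subseteq> \<Omega>"
    let ?I = "integral (cube c (2 * r)) (\<lambda>x. norm (f x) powr p)"
    have "((\<lambda>x. norm (f x) powr p) has_integral ?I) (cube c (2 * r))"
      using harmonic_powr_integrable_on_cube[OF f sub p] by (rule integrable_integral)
    then have "(\<integral>\<^sup>+x\<in>cube c (2 * r). ennreal (norm (f x) powr p) \<partial>lborel) = ennreal ?I"
      by (rule nn_integral_has_integral_lebesgue'[rotated]) simp
    then show "ennreal (norm (f c) powr p)
       \<le> ennreal (K / r ^ DIM('a)) * (\<integral>\<^sup>+x\<in>cube c (2 * r). ennreal (norm (f x) powr p) \<partial>lborel)"
      using avg[OF \<Omega> f r sub] K r integral_nonneg[OF harmonic_powr_integrable_on_cube[OF f sub p]]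
      by (simp add: ennreal_mult'[symmetric])
  qed
qed

section \<open>Tensor products of harmonic functions\<close>

definition tensor :: "('m::finite \<Rightarrow> 'a \<Rightarrow> complex) \<Rightarrow> 'a ^ 'm \<Rightarrow> complex" where
  "tensor g Z = (\<Prod>j\<in>UNIV. g j (Z $ j))"

text \<open>
  The total derivative of a tensor product by the product rule. The directional derivative along a
  basis vector in slot \<open>i\<close> replaces the \<open>i\<close>-th factor by its directional derivative, so all
  derivatives of tensor products are again tensor products.
\<close>

definition tensor_deriv :: "('m::finite \<Rightarrow> 'a::euclidean_space \<Rightarrow> complex) \<Rightarrow> 'a ^ 'm \<Rightarrow> 'a ^ 'm \<Rightarrow> complex" where
  "tensor_deriv g Z H = (\<Sum>i\<in>UNIV. \<Sum>u\<in>Basis. (H $ i \<bullet> u) *\<^sub>R tensor (g(i := dir_deriv u (g i))) Z)"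

lemma tensor_fun_upd: "tensor (g(i := h)) Z = h (Z $ i) * (\<Prod>j\<in>UNIV - {i}. g j (Z $ j))"
  unfolding tensor_def by (subst prod.remove[of UNIV i]) auto

lemma has_derivative_tensor:
  assumes "\<And>j. g j differentiable (at (Z $ j))"
  shows "(tensor g has_derivative tensor_deriv g Z) (at Z)"
proof -
  have g: "((\<lambda>Z. g i (Z $ i)) has_derivative
      (\<lambda>H. \<Sum>u\<in>Basis. (H $ i \<bullet> u) *\<^sub>R dir_deriv u (g i) (Z $ i))) (at Z)" for i
    by (rule has_derivative_compose[OF bounded_linear_imp_has_derivative[OF bounded_linear_vec_nth]
          has_derivative_dir_deriv[OF assms]])
  have "(tensor g has_derivative
      (\<lambda>H. \<Sum>i\<in>UNIV. (\<Sum>u\<in>Basis. (H $ i \<bullet> u) *\<^sub>R dir_deriv u (g i) (Z $ i)) * (\<Prod>j\<in>UNIV - {i}. g j (Z $ j)))) (at Z)"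
    unfolding tensor_def[abs_def] by (rule has_derivative_prod[OF g])
  then show ?thesis
    by (rule has_derivative_eq_rhs)
      (simp add: fun_eq_iff tensor_deriv_def tensor_fun_upd sum_distrib_right)
qed

lemma tensor_deriv_axis:
  assumes u: "u \<in> Basis"
  shows "tensor_deriv g Z (axis i u) = tensor (g(i := dir_deriv u (g i))) Z"
proof -
  have "tensor_deriv g Z (axis i u) =
      (\<Sum>k\<in>UNIV. if k = i then (\<Sum>v\<in>Basis. (u \<bullet> v) *\<^sub>R tensor (g(k := dir_deriv v (g k))) Z) else 0)"
    unfolding tensor_deriv_def by (intro sum.cong refl) (auto simp: axis_def)
  then show ?thesis using u by (simp add: sum_inner_Basis_scaleR)
qed

lemma sum_Basis_vec:
  "(\<Sum>b\<in>(Basis :: ('a::euclidean_space ^ 'm::finite) set). F b) = (\<Sum>i\<in>UNIV. \<Sum>u\<in>Basis. F (axis i u))"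
proof -
  have "(\<Sum>i\<in>UNIV. \<Sum>u\<in>Basis. F (axis i u)) = (\<Sum>(i, u)\<in>UNIV \<times> (Basis :: 'a set). F (axis i u :: 'a ^ 'm))"
    by (rule sum.cartesian_product)
  also have "\<dots> = (\<Sum>b\<in>(Basis :: ('a ^ 'm) set). F b)"
    by (rule sum.reindex_cong[of "\<lambda>(i, u). axis i u", symmetric])
      (auto simp: inj_on_def axis_eq_axis nonzero_Basis Basis_vec_def)
  finally show ?thesis ..
qed

lemma prod_Basis_vec:
  "(\<Prod>b\<in>(Basis :: ('a::euclidean_space ^ 'm::finite) set). F b) = (\<Prod>i\<in>UNIV. \<Prod>u\<in>Basis. F (axis i u))"
proof -
  have "(\<Prod>i\<in>UNIV. \<Prod>u\<in>Basis. F (axis i u)) = (\<Prod>(i, u)\<in>UNIV \<times> (Basis :: 'a set). F (axis i u :: 'a ^ 'm))"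
    by (rule prod.cartesian_product)
  also have "\<dots> = (\<Prod>b\<in>(Basis :: ('a ^ 'm) set). F b)"
    by (rule prod.reindex_cong[of "\<lambda>(i, u). axis i u", symmetric])
      (auto simp: inj_on_def axis_eq_axis nonzero_Basis Basis_vec_def)
  finally show ?thesis ..
qed

lemma open_vec_pow: "open S \<Longrightarrow> open {Z :: 'a::topological_space ^ 'm::finite. \<forall>j. Z $ j \<in> S}"
proof -
  assume "open S"
  then have "open (\<Inter>j\<in>UNIV. {Z :: 'a ^ 'm. Z $ j \<in> S})"
    by (intro open_INT finite ballI open_vimage_vec_nth[unfolded vimage_def])
  moreover have "(\<Inter>j\<in>UNIV. {Z :: 'a ^ 'm. Z $ j \<in> S}) = {Z. \<forall>j. Z $ j \<in> S}" by auto
  ultimately show ?thesis by simp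
qed

lemma continuous_on_tensor:
  assumes "\<And>j. continuous_on S (g j)"
  shows "continuous_on {Z. \<forall>j. Z $ j \<in> S} (tensor g)"
  unfolding tensor_def[abs_def]
proof (rule continuous_on_prod)
  fix j
  show "continuous_on {Z. \<forall>j. Z $ j \<in> S} (\<lambda>Z. g j (Z $ j))"
    by (rule continuous_on_compose2[OF assms]) (auto intro!: continuous_intros)
qed

text \<open>
  The Laplacian of the tensor product is the sum over \<open>i\<close> of the tensor products in which the
  \<open>i\<close>-th factor is replaced by its Laplacian.
\<close>

lemma harmonic_on_tensor:
  fixes g :: "'m::finite \<Rightarrow> 'a::euclidean_space \<Rightarrow> complex"
  assumes S: "open S" and g: "\<And>j. harmonic_on S (g j)"
  shows "harmonic_on {Z. \<forall>j. Z $ j \<in> S} (tensor g)"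
proof -
  have "\<forall>b\<in>(Basis :: ('a ^ 'm) set). \<exists>i u. b = axis i u \<and> u \<in> Basis"
    by (auto simp: Basis_vec_def)
  then obtain i u where iu: "\<And>b :: 'a ^ 'm. b \<in> Basis \<Longrightarrow> b = axis (i b) (u b) \<and> u b \<in> Basis"
    by metis
  \<comment> \<open>A basis vector of the power is a basis vector \<open>u b\<close> in slot \<open>i b\<close>.\<close>
  define G where "G b = g(i b := dir_deriv (u b) (g (i b)))" for b
  have diff: "g j differentiable (at z)" "v \<in> Basis \<Longrightarrow> dir_deriv v (g j) differentiable (at z)" if "z \<in> S" for j z v
    using g[of j] that by (auto simp: harmonic_on_def C2_on_def)
  have cont: "continuous_on S (g j)" "v \<in> Basis \<Longrightarrow> continuous_on S (dir_deriv v (g j))"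
     "v \<in> Basis \<Longrightarrow> w \<in> Basis \<Longrightarrow> continuous_on S (dir_deriv w (dir_deriv v (g j)))" for j v w
  proof -
    show "continuous_on S (g j)" using g by (rule harmonic_on_imp_continuous_on)
    show "v \<in> Basis \<Longrightarrow> continuous_on S (dir_deriv v (g j))"
      using g by (rule harmonic_on_imp_continuous_on_dir_deriv)
    show "v \<in> Basis \<Longrightarrow> w \<in> Basis \<Longrightarrow> continuous_on S (dir_deriv w (dir_deriv v (g j)))"
      using g[of j] by (simp add: harmonic_on_def C2_on_def)
  qed
  show ?thesis
  proof (rule harmonic_onI[where f' = "tensor_deriv g" and f'' = "\<lambda>b. tensor_deriv (G b)"])
    show "open {Z :: 'a ^ 'm. \<forall>j. Z $ j \<in> S}" using S by (rule open_vec_pow)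
  next
    fix Z :: "'a ^ 'm" assume Z: "Z \<in> {Z. \<forall>j. Z $ j \<in> S}"
    then show "(tensor g has_derivative tensor_deriv g Z) (at Z)"
      by (intro has_derivative_tensor diff) auto
    fix b :: "'a ^ 'm" assume b: "b \<in> Basis"
    have "tensor_deriv g Z b = tensor (G b) Z" for Z
      using iu[OF b] tensor_deriv_axis[of "u b" g Z "i b"] by (simp add: G_def)
    moreover have "(tensor (G b) has_derivative tensor_deriv (G b) Z) (at Z)"
      using Z iu[OF b] by (intro has_derivative_tensor) (auto simp: G_def diff)
    ultimately show "((\<lambda>Z. tensor_deriv g Z b) has_derivative tensor_deriv (G b) Z) (at Z)"
      by simp
  next
    fix b b' :: "'a ^ 'm" assume b: "b \<in> Basis" "b' \<in> Basis"
    have "tensor_deriv (G b) Z b' = tensor ((G b)(i b' := dir_deriv (u b') (G b (i b')))) Z" for Z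
      using iu[OF b(2)] tensor_deriv_axis[of "u b'" "G b" Z "i b'"] by simp
    moreover have "continuous_on S (((G b)(i b' := dir_deriv (u b') (G b (i b')))) j)" for j
      using iu[OF b(1)] iu[OF b(2)] by (auto simp: G_def cont)
    then have "continuous_on {Z. \<forall>j. Z $ j \<in> S} (tensor ((G b)(i b' := dir_deriv (u b') (G b (i b')))))"
      by (rule continuous_on_tensor)
    ultimately show "continuous_on {Z. \<forall>j. Z $ j \<in> S} (\<lambda>Z. tensor_deriv (G b) Z b')"
      by simp
  next
    fix Z :: "'a ^ 'm" assume Z: "Z \<in> {Z. \<forall>j. Z $ j \<in> S}"
    have "tensor_deriv (G (axis k v)) Z (axis k v) =
        dir_deriv v (dir_deriv v (g k)) (Z $ k) * (\<Prod>j\<in>UNIV - {k}. g j (Z $ j))" if v: "v \<in> Basis" for k v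
    proof -
      have "axis k v = axis (i (axis k v)) (u (axis k v))"
        using iu[of "axis k v"] v by (auto simp: Basis_vec_def)
      then have "i (axis k v) = k" "u (axis k v) = v"
        using v nonzero_Basis by (auto simp: axis_eq_axis)
      then show ?thesis
        using v by (simp add: tensor_deriv_axis G_def tensor_fun_upd)
    qed
    then have "(\<Sum>b\<in>Basis. tensor_deriv (G b) Z b) =
        (\<Sum>k\<in>UNIV. laplacian (g k) (Z $ k) * (\<Prod>j\<in>UNIV - {k}. g j (Z $ j)))"
      by (simp add: sum_Basis_vec laplacian_def sum_distrib_right)
    also have "\<dots> = 0"
      using g Z by (intro sum.neutral) (auto simp: harmonic_on_def)
    finally show "(\<Sum>b\<in>Basis. tensor_deriv (G b) Z b) = 0" .
  qed
qed

lemma harmonic_on_mult_left: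
  fixes f :: "'a::euclidean_space \<Rightarrow> complex"
  assumes S: "open S" and f: "harmonic_on S f"
  shows "harmonic_on S (\<lambda>z. a * f z)"
proof (rule harmonic_onI[OF S, where
      f' = "\<lambda>z h. a * (\<Sum>b\<in>Basis. (h \<bullet> b) *\<^sub>R dir_deriv b f z)" and
      f'' = "\<lambda>b z h. a * (\<Sum>b'\<in>Basis. (h \<bullet> b') *\<^sub>R dir_deriv b' (dir_deriv b f) z)"])
  fix z assume z: "z \<in> S"
  show "((\<lambda>z. a * f z) has_derivative (\<lambda>h. a * (\<Sum>b\<in>Basis. (h \<bullet> b) *\<^sub>R dir_deriv b f z))) (at z)"
    using z f by (intro has_derivative_mult_right has_derivative_dir_deriv) (auto simp: harmonic_on_def C2_on_def)
  show "(\<Sum>b\<in>Basis. a * (\<Sum>b'\<in>Basis. (b \<bullet> b') *\<^sub>R dir_deriv b' (dir_deriv b f) z)) = 0"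
    using z f by (simp add: sum_inner_Basis_scaleR harmonic_on_def laplacian_def flip: sum_distrib_left)
  fix b :: 'a assume b: "b \<in> Basis"
  show "((\<lambda>z. a * (\<Sum>b'\<in>Basis. (b \<bullet> b') *\<^sub>R dir_deriv b' f z)) has_derivative
       (\<lambda>h. a * (\<Sum>b'\<in>Basis. (h \<bullet> b') *\<^sub>R dir_deriv b' (dir_deriv b f) z))) (at z)"
    using z f b unfolding sum_inner_Basis_scaleR[OF b]
    by (intro has_derivative_mult_right has_derivative_dir_deriv) (auto simp: harmonic_on_def C2_on_def)
next
  fix b b' :: 'a assume b: "b \<in> Basis" "b' \<in> Basis"
  show "continuous_on S (\<lambda>z. a * (\<Sum>v\<in>Basis. (b' \<bullet> v) *\<^sub>R dir_deriv v (dir_deriv b f) z))"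
    using f b by (intro continuous_intros) (auto simp: harmonic_on_def C2_on_def)
qed

section \<open>Product integrals on powers of a Euclidean space\<close>

lemma measurable_vec_nth_euclidean [measurable]:
  "(\<lambda>Z :: 'a::euclidean_space ^ 'm::finite. Z $ j) \<in> borel_measurable borel"
  by (intro borel_measurable_continuous_onI continuous_intros)

lemma borel_measurable_vec_lambda:
  "(vec_lambda :: _ \<Rightarrow> 'a::euclidean_space ^ 'm::finite) \<in> borel_measurable (Pi\<^sub>M UNIV (\<lambda>_. lborel))"
proof (subst borel_measurable_euclidean_space, rule ballI)
  fix b :: "'a ^ 'm" assume "b \<in> Basis"
  then obtain i u where "b = axis i u" by (auto simp: Basis_vec_def)
  then show "(\<lambda>F. vec_lambda F \<bullet> b) \<in> borel_measurable (Pi\<^sub>M UNIV (\<lambda>_. lborel :: 'a measure))"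
    by (simp add: inner_axis)
qed

text \<open>
  Both sides give a box the product of its side lengths.
\<close>

lemma lborel_vec_eq_distr_PiM:
  "(lborel :: ('a::euclidean_space ^ 'm::finite) measure) = distr (Pi\<^sub>M UNIV (\<lambda>_. lborel)) borel vec_lambda"
proof (rule lborel_eqI)
  interpret product_sigma_finite "\<lambda>_ :: 'm. lborel :: 'a measure" by standard
  note meas = borel_measurable_vec_lambda[where 'a = 'a and 'm = 'm]
  fix l u :: "'a ^ 'm" assume le: "\<And>b. b \<in> Basis \<Longrightarrow> l \<bullet> b \<le> u \<bullet> b"
  have le': "l $ i \<bullet> v \<le> u $ i \<bullet> v" if "v \<in> Basis" for i v
    using le[of "axis i v"] that by (auto simp: Basis_vec_def inner_axis)
  have "vec_lambda -` box l u \<inter> space (Pi\<^sub>M UNIV (\<lambda>_. lborel)) = (\<Pi>\<^sub>E i\<in>UNIV. box (l $ i) (u $ i))"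
    by (auto simp: space_PiM mem_box Basis_vec_def inner_axis PiE_UNIV_domain Pi_iff)
  then have "emeasure (distr (Pi\<^sub>M UNIV (\<lambda>_. lborel)) borel vec_lambda) (box l u)
      = emeasure (Pi\<^sub>M UNIV (\<lambda>_. lborel)) (\<Pi>\<^sub>E i\<in>UNIV. box (l $ i) (u $ i))"
    by (simp add: emeasure_distr meas)
  also have "\<dots> = (\<Prod>i\<in>UNIV. emeasure lborel (box (l $ i) (u $ i)))"
    by (rule emeasure_PiM) auto
  also have "\<dots> = (\<Prod>i\<in>UNIV. ennreal (\<Prod>v\<in>Basis. (u $ i - l $ i) \<bullet> v))"
    by (simp add: emeasure_lborel_box le')
  also have "\<dots> = ennreal (\<Prod>i\<in>UNIV. \<Prod>v\<in>Basis. (u $ i - l $ i) \<bullet> v)"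
    by (intro prod_ennreal prod_nonneg) (auto simp: inner_diff_left le')
  also have "(\<Prod>i\<in>UNIV. \<Prod>v\<in>Basis. (u $ i - l $ i) \<bullet> v) = (\<Prod>b\<in>Basis. (u - l) \<bullet> b)"
    by (simp add: prod_Basis_vec inner_axis)
  finally show "emeasure (distr (Pi\<^sub>M UNIV (\<lambda>_. lborel)) borel vec_lambda) (box l u) = (\<Prod>b\<in>Basis. (u - l) \<bullet> b)" .
qed simp

lemma nn_integral_lborel_vec_prod:
  fixes h :: "'m::finite \<Rightarrow> 'a::euclidean_space \<Rightarrow> ennreal"
  assumes [measurable]: "\<And>j. h j \<in> borel_measurable borel"
  shows "(\<integral>\<^sup>+Z. (\<Prod>j\<in>UNIV. h j (Z $ j)) \<partial>lborel) = (\<Prod>j\<in>UNIV. \<integral>\<^sup>+z. h j z \<partial>lborel)"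
proof -
  interpret product_sigma_finite "\<lambda>_ :: 'm. lborel :: 'a measure" by standard
  have "(\<integral>\<^sup>+Z. (\<Prod>j\<in>UNIV. h j (Z $ j)) \<partial>(lborel :: ('a ^ 'm) measure))
      = (\<integral>\<^sup>+F. (\<Prod>j\<in>UNIV. h j (F j)) \<partial>(Pi\<^sub>M UNIV (\<lambda>_. lborel)))"
    by (subst lborel_vec_eq_distr_PiM, subst nn_integral_distr[OF borel_measurable_vec_lambda]) auto
  also have "\<dots> = (\<Prod>j\<in>UNIV. \<integral>\<^sup>+z. h j z \<partial>lborel)"
    by (rule product_nn_integral_prod) auto
  finally show ?thesis .
qed

section \<open>Bergman norms as nonnegative integrals\<close>

lemma Lp_iff:
  "f \<in> Lp M p \<longleftrightarrow> f \<in> borel_measurable M \<and> (\<integral>\<^sup>+x. ennreal (norm (f x) powr p) \<partial>M) < \<infinity>"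
proof
  assume "f \<in> Lp M p"
  then show "f \<in> borel_measurable M \<and> (\<integral>\<^sup>+x. ennreal (norm (f x) powr p) \<partial>M) < \<infinity>"
    by (auto simp: Lp_def integrable_iff_bounded)
next
  assume f: "f \<in> borel_measurable M \<and> (\<integral>\<^sup>+x. ennreal (norm (f x) powr p) \<partial>M) < \<infinity>"
  then have "integrable M (\<lambda>x. norm (f x) powr p)"
    by (intro integrableI_bounded) auto
  then show "f \<in> Lp M p" using f by (simp add: Lp_def)
qed

lemma Lp_norm_nonneg: "Lp_norm M p f \<ge> 0"
  by (simp add: Lp_norm_def)

lemma Lp_norm_powr:
  assumes "f \<in> Lp M p" "p > 0"
  shows "ennreal (Lp_norm M p f powr p) = (\<integral>\<^sup>+x. ennreal (norm (f x) powr p) \<partial>M)"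
proof -
  have int: "integrable M (\<lambda>x. norm (f x) powr p)" using assms by (simp add: Lp_def)
  have "Lp_norm M p f powr p = (LINT x|M. norm (f x) powr p)"
    using assms(2) by (simp add: Lp_norm_def powr_powr)
  then show ?thesis using nn_integral_eq_integral[OF int] by simp
qed

text \<open>
  The Bochner integrals in \<open>Lp_norm\<close> vanish on functions that are not integrable, so boundedness
  of the trace contains a membership statement besides the inequality. In terms of nonnegative
  integrals, where infinite values are allowed, one inequality expresses both, up to measurability.
\<close>

lemma trace_boundedI:
  assumes p: "p > 0" and C: "C \<ge> 0" and X: "X \<subseteq> Lp (weighted_measure_pow s) p"
    and meas: "\<And>f. f \<in> X \<Longrightarrow> Tr f \<in> borel_measurable \<mu>"
    and le: "\<And>f. f \<in> X \<Longrightarrow> (\<integral>\<^sup>+z. ennreal (norm (Tr f z) powr p) \<partial>\<mu>)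
        \<le> ennreal C * (\<integral>\<^sup>+Z. ennreal (norm (f Z) powr p) \<partial>weighted_measure_pow s)"
  shows "trace_bounded X p s \<mu>"
  unfolding trace_bounded_def
proof (intro exI[of _ "C powr (1 / p)"] ballI conjI)
  fix f assume f: "f \<in> X"
  let ?n = "Lp_norm (weighted_measure_pow s) p f"
  have fp: "(\<integral>\<^sup>+Z. ennreal (norm (f Z) powr p) \<partial>weighted_measure_pow s) = ennreal (?n powr p)"
    using Lp_norm_powr[of f] f X p by auto
  have le': "(\<integral>\<^sup>+z. ennreal (norm (Tr f z) powr p) \<partial>\<mu>) \<le> ennreal (C * ?n powr p)"
    using le[OF f] C unfolding fp by (simp add: ennreal_mult)
  then have fin: "(\<integral>\<^sup>+z. ennreal (norm (Tr f z) powr p) \<partial>\<mu>) < \<infinity>"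
    by (rule order.strict_trans1) simp
  then show Lp: "Tr f \<in> Lp \<mu> p" using meas[OF f] by (simp add: Lp_iff)
  have "ennreal (Lp_norm \<mu> p (Tr f) powr p) \<le> ennreal (C * ?n powr p)"
    using le' Lp_norm_powr[OF Lp p] by simp
  then have "Lp_norm \<mu> p (Tr f) powr p \<le> C * ?n powr p"
    using C by (subst (asm) ennreal_le_iff) auto
  then have "(Lp_norm \<mu> p (Tr f) powr p) powr (1 / p) \<le> (C * ?n powr p) powr (1 / p)"
    using p by (intro powr_mono2) auto
  then show "Lp_norm \<mu> p (Tr f) \<le> C powr (1 / p) * ?n"
    using p C Lp_norm_nonneg[of \<mu> p "Tr f"] Lp_norm_nonneg[of "weighted_measure_pow s" p f]
    by (simp add: powr_mult powr_powr)
qed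

lemma trace_boundedD:
  assumes "trace_bounded X p s \<mu>" and p: "p > 0" and X: "X \<subseteq> Lp (weighted_measure_pow s) p"
  obtains C where "C \<ge> 0" and
    "\<And>f. f \<in> X \<Longrightarrow> (\<integral>\<^sup>+z. ennreal (norm (Tr f z) powr p) \<partial>\<mu>)
        \<le> ennreal C * (\<integral>\<^sup>+Z. ennreal (norm (f Z) powr p) \<partial>weighted_measure_pow s)"
proof -
  obtain B where B: "\<And>f. f \<in> X \<Longrightarrow> Tr f \<in> Lp \<mu> p \<and> Lp_norm \<mu> p (Tr f) \<le> B * Lp_norm (weighted_measure_pow s) p f"
    using assms(1) by (auto simp: trace_bounded_def)
  show ?thesis
  proof (rule that[of "\<bar>B\<bar> powr p"])
    fix f assume f: "f \<in> X"
    let ?n = "Lp_norm (weighted_measure_pow s) p f"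
    have n: "?n \<ge> 0" by (rule Lp_norm_nonneg)
    have "Lp_norm \<mu> p (Tr f) \<le> \<bar>B\<bar> * ?n"
      using B[OF f] mult_right_mono[OF abs_ge_self[of B] n] by linarith
    then have "Lp_norm \<mu> p (Tr f) powr p \<le> (\<bar>B\<bar> * ?n) powr p"
      using p by (intro powr_mono2 Lp_norm_nonneg) auto
    also have "\<dots> = \<bar>B\<bar> powr p * ?n powr p" using n by (simp add: powr_mult)
    finally have "ennreal (Lp_norm \<mu> p (Tr f) powr p) \<le> ennreal (\<bar>B\<bar> powr p) * ennreal (?n powr p)"
      by (simp flip: ennreal_mult)
    then show "(\<integral>\<^sup>+z. ennreal (norm (Tr f z) powr p) \<partial>\<mu>)
        \<le> ennreal (\<bar>B\<bar> powr p) * (\<integral>\<^sup>+Z. ennreal (norm (f Z) powr p) \<partial>weighted_measure_pow s)"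
      using Lp_norm_powr[of "Tr f" \<mu> p] Lp_norm_powr[of f _ p] B[OF f] f X p by auto
  qed simp
qed

section \<open>The weighted measures and norms of tensor products\<close>

lemma open_halfspace: "open (halfspace :: 'n::finite point set)"
  unfolding halfspace_def by (intro open_Collect_less continuous_intros)

lemma halfspace_pow_eq: "halfspace_pow = {Z. \<forall>j. Z $ j \<in> halfspace}"
  by (simp add: halfspace_pow_def)

lemma open_halfspace_pow: "open (halfspace_pow :: ('n::finite point ^ 'm::finite) set)"
  unfolding halfspace_pow_eq by (intro open_vec_pow open_halfspace)

lemma borel_measurable_weighted_measure:
  "borel_measurable (weighted_measure a) = borel_measurable (restrict_space borel halfspace)"
  unfolding weighted_measure_def by (intro measurable_cong_sets) (auto simp: sets_restrict_space)

lemma borel_measurable_weighted_measure_pow: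
  "borel_measurable (weighted_measure_pow s) = borel_measurable (restrict_space borel halfspace_pow)"
  unfolding weighted_measure_pow_def by (intro measurable_cong_sets) (auto simp: sets_restrict_space)

lemma nn_integral_density_restrict_lborel:
  fixes h w :: "'a::euclidean_space \<Rightarrow> ennreal"
  assumes S: "open S" and h: "h \<in> borel_measurable (restrict_space borel S)"
    and w: "w \<in> borel_measurable borel"
  shows "(\<integral>\<^sup>+z. h z \<partial>density (restrict_space lborel S) w) = (\<integral>\<^sup>+z. w z * (h z * indicator S z) \<partial>lborel)"
proof -
  have sets: "sets (restrict_space lborel S) = sets (restrict_space borel S)"
    by (simp add: sets_restrict_space)
  have "h \<in> borel_measurable (restrict_space lborel S)" "w \<in> borel_measurable (restrict_space lborel S)"
    using h measurable_restrict_space1[OF w, of S] by (simp_all cong: measurable_cong_sets add: measurable_cong_sets[OF sets refl])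
  then have "(\<integral>\<^sup>+z. h z \<partial>density (restrict_space lborel S) w) = (\<integral>\<^sup>+z. w z * h z \<partial>restrict_space lborel S)"
    by (intro nn_integral_density) auto
  also have "\<dots> = (\<integral>\<^sup>+z. w z * h z * indicator S z \<partial>lborel)"
    using S by (subst nn_integral_restrict_space) (auto intro: borel_open)
  finally show ?thesis by (simp add: mult.assoc)
qed

lemma measurable_snd_powr [measurable]: "(\<lambda>z :: 'n::finite point. snd z powr a) \<in> borel_measurable borel"
proof -
  have [measurable]: "(snd :: 'n point \<Rightarrow> real) \<in> borel_measurable borel"
    by (intro borel_measurable_continuous_onI continuous_intros)
  show ?thesis by measurable
qed

lemma nn_integral_weighted_measure:
  fixes h :: "'n::finite point \<Rightarrow> ennreal"
  assumes "h \<in> borel_measurable (restrict_space borel halfspace)"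
  shows "(\<integral>\<^sup>+z. h z \<partial>weighted_measure a)
    = (\<integral>\<^sup>+z. ennreal (snd z powr a) * (h z * indicator halfspace z) \<partial>lborel)"
  unfolding weighted_measure_def
  by (rule nn_integral_density_restrict_lborel[OF open_halfspace assms]) measurable

lemma nn_integral_weighted_measure_pow:
  fixes h :: "'n::finite point ^ 'm::finite \<Rightarrow> ennreal"
  assumes "h \<in> borel_measurable (restrict_space borel halfspace_pow)"
  shows "(\<integral>\<^sup>+Z. h Z \<partial>weighted_measure_pow s)
    = (\<integral>\<^sup>+Z. ennreal (\<Prod>j\<in>UNIV. snd (Z $ j) powr s j) * (h Z * indicator halfspace_pow Z) \<partial>lborel)"
  unfolding weighted_measure_pow_def
  by (rule nn_integral_density_restrict_lborel[OF open_halfspace_pow assms]) measurable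

lemma borel_measurable_harmonic_powr:
  assumes "harmonic_on S f"
  shows "f \<in> borel_measurable (restrict_space borel S)"
    and "(\<lambda>x. ennreal (norm (f x) powr p)) \<in> borel_measurable (restrict_space borel S)"
proof -
  show [measurable]: "f \<in> borel_measurable (restrict_space borel S)"
    using harmonic_on_imp_continuous_on[OF assms] by (rule borel_measurable_continuous_on_restrict)
  show "(\<lambda>x. ennreal (norm (f x) powr p)) \<in> borel_measurable (restrict_space borel S)"
    by measurable
qed

text \<open>
  The density of the product measure is the product of the weights, and the indicator of the power
  of the half-space is the product of the indicators, so the integrand factorises.
\<close>

lemma nn_integral_tensor_powr:
  fixes f :: "'m::finite \<Rightarrow> 'n::finite point \<Rightarrow> complex"
  assumes f: "\<And>j. harmonic_on halfspace (f j)"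
  shows "(\<integral>\<^sup>+Z. ennreal (norm (tensor f Z) powr p) \<partial>weighted_measure_pow s)
    = (\<Prod>j\<in>UNIV. \<integral>\<^sup>+z. ennreal (norm (f j z) powr p) \<partial>weighted_measure (s j))"
proof -
  define h where "h j z = ennreal (snd z powr s j) * (ennreal (norm (f j z) powr p) * indicator halfspace z)"
    for j and z :: "'n point"
  have "(\<lambda>z. ennreal (norm (f j z) powr p) * indicator halfspace z) \<in> borel_measurable borel" for j
    using borel_measurable_harmonic_powr(2)[OF f] open_halfspace
    by (subst borel_measurable_restrict_space_iff_ennreal[symmetric]) (auto intro: borel_open)
  then have h: "h j \<in> borel_measurable borel" for j
    unfolding h_def by measurable
  have "harmonic_on halfspace_pow (tensor f)"
    unfolding halfspace_pow_eq by (rule harmonic_on_tensor[OF open_halfspace f])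
  then have "(\<integral>\<^sup>+Z. ennreal (norm (tensor f Z) powr p) \<partial>weighted_measure_pow s)
     = (\<integral>\<^sup>+Z. ennreal (\<Prod>j\<in>UNIV. snd (Z $ j) powr s j) *
          (ennreal (norm (tensor f Z) powr p) * indicator halfspace_pow Z) \<partial>lborel)"
    by (intro nn_integral_weighted_measure_pow borel_measurable_harmonic_powr(2))
  also have "\<dots> = (\<integral>\<^sup>+Z. (\<Prod>j\<in>UNIV. h j (Z $ j)) \<partial>lborel)"
  proof (rule nn_integral_cong)
    fix Z :: "'n point ^ 'm"
    have ind: "indicator halfspace_pow Z = (\<Prod>j\<in>UNIV. indicator halfspace (Z $ j) :: ennreal)"
    proof (cases "Z \<in> halfspace_pow")
      case False
      then obtain j where "Z $ j \<notin> halfspace" by (auto simp: halfspace_pow_def)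
      then have "(\<Prod>j\<in>UNIV. indicator halfspace (Z $ j) :: ennreal) = 0"
        by (intro prod_zero bexI[of _ j]) auto
      then show ?thesis using False by simp
    qed (auto simp: halfspace_pow_def)
    show "ennreal (\<Prod>j\<in>UNIV. snd (Z $ j) powr s j) *
          (ennreal (norm (tensor f Z) powr p) * indicator halfspace_pow Z) = (\<Prod>j\<in>UNIV. h j (Z $ j))"
      unfolding h_def ind prod.distrib tensor_def prod_norm[symmetric]
      by (simp add: prod_ennreal prod_powr_distrib)
  qed
  also have "\<dots> = (\<Prod>j\<in>UNIV. \<integral>\<^sup>+z. h j z \<partial>lborel)"
    by (rule nn_integral_lborel_vec_prod[OF h])
  also have "\<dots> = (\<Prod>j\<in>UNIV. \<integral>\<^sup>+z. ennreal (norm (f j z) powr p) \<partial>weighted_measure (s j))"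
    unfolding h_def by (intro prod.cong refl nn_integral_weighted_measure[symmetric] borel_measurable_harmonic_powr(2) f)
  finally show ?thesis .
qed

lemma tensor_in_sep_bergman_pow:
  assumes p: "p > 0" and f: "\<And>j. f j \<in> bergman p (s j)"
  shows "tensor f \<in> sep_bergman_pow p s"
proof -
  have harm: "harmonic_on halfspace (f j)" for j
    using f[of j] by (simp add: bergman_def)
  have tens: "harmonic_on halfspace_pow (tensor f)"
    unfolding halfspace_pow_eq by (rule harmonic_on_tensor[OF open_halfspace harm])
  have "(\<integral>\<^sup>+z. ennreal (norm (f j z) powr p) \<partial>weighted_measure (s j)) < \<infinity>" for j
    using f[of j] by (simp add: bergman_def Lp_iff)
  then have "(\<integral>\<^sup>+Z. ennreal (norm (tensor f Z) powr p) \<partial>weighted_measure_pow s) < \<infinity>"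
    unfolding nn_integral_tensor_powr[OF harm] by (simp add: less_top[symmetric] ennreal_prod_eq_top)
  moreover have "separately_harmonic (tensor f)"
    unfolding separately_harmonic_def
  proof (intro ballI allI)
    fix Z :: "'b point ^ 'a" and j
    have "tensor f (\<chi> i. if i = j then w else Z $ i) = (\<Prod>i\<in>UNIV - {j}. f i (Z $ i)) * f j w" for w
      unfolding tensor_def by (subst prod.remove[of UNIV j]) (auto simp: mult.commute)
    then show "harmonic_on halfspace (\<lambda>w. tensor f (\<chi> i. if i = j then w else Z $ i))"
      using harmonic_on_mult_left[OF open_halfspace harm] by simp
  qed
  ultimately show ?thesis
    using tens borel_measurable_harmonic_powr(1)[OF tens]
    by (simp add: sep_bergman_pow_def bergman_pow_def Lp_iff borel_measurable_weighted_measure_pow)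
qed

lemma trace_bounded_imp_product_bounded:
  fixes s :: "'m::finite \<Rightarrow> real" and \<mu> :: "'n::finite point measure"
  assumes p: "p > 0" and tr: "trace_bounded (sep_bergman_pow p s) p s \<mu>"
  shows "product_bounded p s \<mu>"
proof -
  have "sep_bergman_pow p s \<subseteq> (Lp (weighted_measure_pow s) p :: ('n point ^ 'm \<Rightarrow> complex) set)"
    by (auto simp: sep_bergman_pow_def bergman_pow_def)
  from trace_boundedD[OF tr p this] obtain C where C: "C \<ge> 0" and
    bd: "\<And>f. f \<in> sep_bergman_pow p s \<Longrightarrow> (\<integral>\<^sup>+z. ennreal (norm (Tr f z) powr p) \<partial>\<mu>)
        \<le> ennreal C * (\<integral>\<^sup>+Z. ennreal (norm (f Z) powr p) \<partial>weighted_measure_pow s)"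
    by blast
  show ?thesis
    unfolding product_bounded_def
  proof (intro exI[of _ C] allI impI)
    fix f :: "'m \<Rightarrow> 'n point \<Rightarrow> complex" assume f: "\<forall>j. f j \<in> bergman p (s j)"
    have "(\<integral>\<^sup>+z. ennreal (\<Prod>j\<in>UNIV. norm (f j z) powr p) \<partial>\<mu>)
        = (\<integral>\<^sup>+z. ennreal (norm (Tr (tensor f) z) powr p) \<partial>\<mu>)"
      by (simp add: Tr_def tensor_def prod_powr_distrib flip: prod_norm)
    also have "\<dots> \<le> ennreal C * (\<integral>\<^sup>+Z. ennreal (norm (tensor f Z) powr p) \<partial>weighted_measure_pow s)"
      using f by (intro bd tensor_in_sep_bergman_pow p) auto
    also have "\<dots> = ennreal C * (\<Prod>j\<in>UNIV. \<integral>\<^sup>+z. ennreal (norm (f j z) powr p) \<partial>weighted_measure (s j))"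
      using f by (subst nn_integral_tensor_powr) (auto simp: bergman_def)
    also have "\<dots> = ennreal C * (\<Prod>j\<in>UNIV. ennreal (Lp_norm (weighted_measure (s j)) p (f j) powr p))"
      using f p by (simp add: Lp_norm_powr bergman_def)
    also have "\<dots> = ennreal (C * (\<Prod>j\<in>UNIV. Lp_norm (weighted_measure (s j)) p (f j) powr p))"
      using C by (simp add: prod_ennreal ennreal_mult prod_nonneg)
    finally show "(\<integral>\<^sup>+z. ennreal (\<Prod>j\<in>UNIV. norm (f j z) powr p) \<partial>\<mu>)
        \<le> ennreal (C * (\<Prod>j\<in>UNIV. Lp_norm (weighted_measure (s j)) p (f j) powr p))" .
  qed
qed

section \<open>Harmonic functions of fast decay\<close>

definition lin2 :: "'a::euclidean_space \<Rightarrow> 'a \<Rightarrow> 'a \<Rightarrow> complex" where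
  "lin2 e0 e1 h = Complex (h \<bullet> e0) (h \<bullet> e1)"

text \<open>
  For distinct basis vectors \<open>e0\<close>, \<open>e1\<close> and \<open>2 * a = 2 * l + DIM - 2\<close> this is the Kelvin transform with pole \<open>w\<close> of the polynomial
  \<open>(x \<bullet> e0 + \<i> * (x \<bullet> e1)) ^ l\<close>, which is homogeneous and harmonic. The exponent \<open>a\<close> is a separate parameter because
  differentiation changes \<open>l\<close> and \<open>a\<close> independently.
\<close>

definition kelvin :: "'a::euclidean_space \<Rightarrow> 'a \<Rightarrow> 'a \<Rightarrow> nat \<Rightarrow> real \<Rightarrow> 'a \<Rightarrow> complex" where
  "kelvin e0 e1 w l a z = lin2 e0 e1 (z - w) ^ l * of_real (((z - w) \<bullet> (z - w)) powr (- a))"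

definition kelvin_deriv :: "'a::euclidean_space \<Rightarrow> 'a \<Rightarrow> 'a \<Rightarrow> nat \<Rightarrow> real \<Rightarrow> 'a \<Rightarrow> 'a \<Rightarrow> complex" where
  "kelvin_deriv e0 e1 w l a z h = of_nat l * lin2 e0 e1 h * kelvin e0 e1 w (l - 1) a z
     - (2 * a * ((z - w) \<bullet> h)) *\<^sub>R kelvin e0 e1 w l (a + 1) z"

lemma lin2_eq: "lin2 e0 e1 h = of_real (h \<bullet> e0) + \<i> * of_real (h \<bullet> e1)"
  by (simp add: lin2_def complex_eq_iff)

lemma has_derivative_kelvin:
  assumes "z \<noteq> w"
  shows "(kelvin e0 e1 w l a has_derivative kelvin_deriv e0 e1 w l a z) (at z)"
proof -
  have pos: "(z - w) \<bullet> (z - w) > 0" using assms by simp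
  have lin: "((\<lambda>z. lin2 e0 e1 (z - w)) has_derivative lin2 e0 e1) (at z)"
    unfolding lin2_eq[abs_def] by (auto intro!: derivative_eq_intros)
  have pow: "((\<lambda>z. lin2 e0 e1 (z - w) ^ l) has_derivative
      (\<lambda>h. of_nat l * lin2 e0 e1 h * lin2 e0 e1 (z - w) ^ (l - 1))) (at z)"
    by (rule has_derivative_eq_rhs[OF has_derivative_power[OF lin]]) (simp add: mult_ac)
  have "((\<lambda>z. (z - w) \<bullet> (z - w)) has_derivative (\<lambda>h. 2 * ((z - w) \<bullet> h))) (at z)"
    by (auto intro!: derivative_eq_intros simp: inner_commute)
  moreover have "((\<lambda>u::real. u powr (- a)) has_derivative (\<lambda>h. h * (- a * ((z - w) \<bullet> (z - w)) powr (- (a + 1)))))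
      (at ((z - w) \<bullet> (z - w)))"
  proof (rule has_derivative_eq_rhs[OF has_real_derivative_powr[OF pos, unfolded has_field_derivative_def]])
    have "- a - 1 = - (a + 1)" by simp
    then show "(*) (- a * ((z - w) \<bullet> (z - w)) powr (- a - 1)) = (\<lambda>h. h * (- a * ((z - w) \<bullet> (z - w)) powr (- (a + 1))))"
      by (simp only: fun_eq_iff mult.commute simp_thms)
  qed
  ultimately have "((\<lambda>z. ((z - w) \<bullet> (z - w)) powr (- a)) has_derivative
      (\<lambda>h. (2 * ((z - w) \<bullet> h)) * (- a * ((z - w) \<bullet> (z - w)) powr (- (a + 1))))) (at z)"
    by (rule has_derivative_compose)
  from has_derivative_mult[OF pow has_derivative_of_real[OF this]]
  show ?thesis
    unfolding kelvin_def[abs_def]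
    by (rule has_derivative_eq_rhs)
      (simp add: fun_eq_iff kelvin_deriv_def kelvin_def scaleR_conv_of_real algebra_simps)
qed

lemma continuous_on_kelvin: "continuous_on (- {w}) (kelvin e0 e1 w l a)"
  using has_derivative_kelvin
  by (intro continuous_at_imp_continuous_on ballI) (auto intro!: has_derivative_continuous)

text \<open>
  Let \<open>\<beta> h = h \<bullet> e0 + \<i> * (h \<bullet> e1)\<close> and \<open>v = z - w\<close>. The second derivatives are combinations of
  the functions \<open>kelvin e0 e1 w\<close> with shifted exponents, and summation over the basis needs only
  \<open>\<Sum> (\<beta> b)\<^sup>2 = 0\<close>, \<open>\<Sum> (v \<bullet> b) * \<beta> b = \<beta> v\<close> and \<open>\<Sum> (v \<bullet> b)\<^sup>2 = v \<bullet> v\<close>. All terms become multiples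
  of the function with exponents \<open>l\<close> and \<open>a + 1\<close>, with total coefficient
  \<open>2 * a * (2 * a - (2 * l + DIM - 2))\<close>.
\<close>

lemma harmonic_on_kelvin:
  fixes w :: "'a::euclidean_space"
  assumes e: "e0 \<in> Basis" "e1 \<in> Basis" "e0 \<noteq> e1"
    and a: "2 * a = 2 * real l + real DIM('a) - 2"
  shows "harmonic_on (- {w}) (kelvin e0 e1 w l a)"
proof (rule harmonic_onI[where f' = "kelvin_deriv e0 e1 w l a" and
    f'' = "\<lambda>b z h. of_nat l * lin2 e0 e1 b * kelvin_deriv e0 e1 w (l - 1) a z h
      - ((2 * a * (h \<bullet> b)) *\<^sub>R kelvin e0 e1 w l (a + 1) z
         + (2 * a * ((z - w) \<bullet> b)) *\<^sub>R kelvin_deriv e0 e1 w l (a + 1) z h)"])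
  fix z b b' :: 'a assume z: "z \<in> - {w}"
  show "(kelvin e0 e1 w l a has_derivative kelvin_deriv e0 e1 w l a z) (at z)"
    using z by (intro has_derivative_kelvin) auto
  have "((\<lambda>z. 2 * a * ((z - w) \<bullet> b)) has_derivative (\<lambda>h. 2 * a * (h \<bullet> b))) (at z)"
    by (auto intro!: derivative_eq_intros)
  from has_derivative_scaleR[OF this has_derivative_kelvin[of z w e0 e1 l "a + 1"]]
  show "((\<lambda>z. kelvin_deriv e0 e1 w l a z b) has_derivative
      (\<lambda>h. of_nat l * lin2 e0 e1 b * kelvin_deriv e0 e1 w (l - 1) a z h
        - ((2 * a * (h \<bullet> b)) *\<^sub>R kelvin e0 e1 w l (a + 1) z
         + (2 * a * ((z - w) \<bullet> b)) *\<^sub>R kelvin_deriv e0 e1 w l (a + 1) z h))) (at z)"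
    unfolding kelvin_deriv_def[of e0 e1 w l a _ b, abs_def] using z
    by (intro has_derivative_diff has_derivative_mult_right has_derivative_kelvin)
      (auto simp: add.commute)
next
  fix b b' :: 'a
  show "continuous_on (- {w}) (\<lambda>z. of_nat l * lin2 e0 e1 b * kelvin_deriv e0 e1 w (l - 1) a z b'
      - ((2 * a * (b' \<bullet> b)) *\<^sub>R kelvin e0 e1 w l (a + 1) z
         + (2 * a * ((z - w) \<bullet> b)) *\<^sub>R kelvin_deriv e0 e1 w l (a + 1) z b'))"
    unfolding kelvin_deriv_def by (intro continuous_intros continuous_on_kelvin)
next
  fix z :: 'a assume z: "z \<in> - {w}"
  define v where "v = z - w"
  define F where "F k c = kelvin e0 e1 w k c z" for k c
  let ?\<beta> = "lin2 e0 e1"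
  have "e0 \<bullet> e1 = 0" "e1 \<bullet> e0 = 0" using e by (auto simp: inner_Basis)
  have inner_sum: "(\<Sum>b\<in>Basis. (x \<bullet> b) * (b \<bullet> y)) = x \<bullet> y" for x y :: 'a
    by (subst (2) euclidean_inner) (simp add: inner_commute)
  have \<beta>\<beta>: "(\<Sum>b\<in>Basis. ?\<beta> b * ?\<beta> b) = 0"
  proof -
    have "(\<Sum>b\<in>Basis. ?\<beta> b * ?\<beta> b) = of_real (\<Sum>b\<in>Basis. (e0 \<bullet> b) * (b \<bullet> e0)) - of_real (\<Sum>b\<in>Basis. (e1 \<bullet> b) * (b \<bullet> e1))
       + 2 * \<i> * of_real (\<Sum>b\<in>Basis. (e0 \<bullet> b) * (b \<bullet> e1))"
      unfolding of_real_sum sum_distrib_left sum.distrib[symmetric] sum_subtractf[symmetric]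
      by (intro sum.cong refl) (simp add: lin2_eq algebra_simps inner_commute)
    then show ?thesis using e \<open>e0 \<bullet> e1 = 0\<close> by (simp add: inner_sum)
  qed
  have v\<beta>: "(\<Sum>b\<in>Basis. of_real (v \<bullet> b) * ?\<beta> b) = ?\<beta> v"
  proof -
    have "(\<Sum>b\<in>Basis. of_real (v \<bullet> b) * ?\<beta> b) = of_real (\<Sum>b\<in>Basis. (v \<bullet> b) * (b \<bullet> e0))
       + \<i> * of_real (\<Sum>b\<in>Basis. (v \<bullet> b) * (b \<bullet> e1))"
      unfolding of_real_sum sum_distrib_left sum.distrib[symmetric]
      by (intro sum.cong refl) (simp add: lin2_eq algebra_simps)
    then show ?thesis by (simp add: inner_sum lin2_eq)
  qed
  have vv: "(\<Sum>b\<in>Basis. of_real (v \<bullet> b) * of_real (v \<bullet> b)) = (of_real (v \<bullet> v) :: complex)"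
    by (subst (3) euclidean_inner) simp
  have step1: "of_nat l * ?\<beta> v * F (l - 1) c = of_nat l * F l c" for c
    by (cases l) (simp_all add: F_def kelvin_def v_def)
  have step2: "of_real (v \<bullet> v) * F l (c + 1) = F l c" for c
  proof -
    have "v \<bullet> v > 0" using z by (simp add: v_def)
    then have "(v \<bullet> v) * (v \<bullet> v) powr (- (c + 1)) = (v \<bullet> v) powr (- c)"
      by (simp add: powr_mult_base)
    then have "of_real (v \<bullet> v) * complex_of_real ((v \<bullet> v) powr (- (c + 1))) = of_real ((v \<bullet> v) powr (- c))"
      by (simp only: of_real_mult[symmetric])
    then show ?thesis
      by (simp only: F_def kelvin_def v_def[symmetric] mult.left_commute[of "of_real (v \<bullet> v)"])
  qed
  have "(\<Sum>b\<in>Basis. of_nat l * ?\<beta> b * kelvin_deriv e0 e1 w (l - 1) a z b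
      - ((2 * a * (b \<bullet> b)) *\<^sub>R kelvin e0 e1 w l (a + 1) z
         + (2 * a * ((z - w) \<bullet> b)) *\<^sub>R kelvin_deriv e0 e1 w l (a + 1) z b))
    = (\<Sum>b\<in>Basis. of_nat l * of_nat (l - 1) * F (l - 1 - 1) a * (?\<beta> b * ?\<beta> b)
      - 2 * of_real a * (of_nat l * F (l - 1) (a + 1)) * (of_real (v \<bullet> b) * ?\<beta> b)
      - 2 * of_real a * F l (a + 1)
      - 2 * of_real a * (of_nat l * F (l - 1) (a + 1)) * (of_real (v \<bullet> b) * ?\<beta> b)
      + 4 * of_real (a * (a + 1)) * F l (a + 1 + 1) * (of_real (v \<bullet> b) * of_real (v \<bullet> b)))"
    by (intro sum.cong refl) (simp add: kelvin_deriv_def F_def v_def[symmetric] scaleR_conv_of_real algebra_simps)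
  also have "\<dots> = - 2 * of_real a * (of_nat l * ?\<beta> v * F (l - 1) (a + 1))
      - 2 * of_real a * of_nat DIM('a) * F l (a + 1)
      - 2 * of_real a * (of_nat l * ?\<beta> v * F (l - 1) (a + 1))
      + 4 * of_real (a * (a + 1)) * (of_real (v \<bullet> v) * F l (a + 1 + 1))"
    unfolding sum.distrib sum_subtractf sum_distrib_left[symmetric] \<beta>\<beta> v\<beta> vv by (simp add: algebra_simps)
  also have "\<dots> = of_real (2 * a) * F l (a + 1) * of_real (2 * a - (2 * real l + real DIM('a) - 2))"
    unfolding step1 step2 by (simp add: algebra_simps)
  also have "\<dots> = 0" using a by simp
  finally show "(\<Sum>b\<in>Basis. of_nat l * ?\<beta> b * kelvin_deriv e0 e1 w (l - 1) a z b
      - ((2 * a * (b \<bullet> b)) *\<^sub>R kelvin e0 e1 w l (a + 1) z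
         + (2 * a * ((z - w) \<bullet> b)) *\<^sub>R kelvin_deriv e0 e1 w l (a + 1) z b)) = 0" .
qed auto

lemma sum_Basis_square: "(\<Sum>b\<in>Basis. (v \<bullet> b)\<^sup>2) = (norm (v::'a::euclidean_space))\<^sup>2"
  by (subst power2_norm_eq_inner, subst euclidean_inner) (simp add: power2_eq_square)

lemma norm_kelvin:
  "norm (kelvin e0 e1 w l a z) = norm (lin2 e0 e1 (z - w)) ^ l * norm (z - w) powr (- (2 * a))"
proof -
  have "((z - w) \<bullet> (z - w)) powr (- a) = norm (z - w) powr (- (2 * a))"
  proof -
    have sq: "(z - w) \<bullet> (z - w) = norm (z - w) powr 2"
      by (subst powr_numeral) (auto simp: power2_norm_eq_inner)
    show ?thesis unfolding sq powr_powr by simp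
  qed
  then show ?thesis by (simp add: kelvin_def norm_mult norm_power)
qed

lemma norm_kelvin_le:
  fixes w :: "'a::euclidean_space"
  assumes e: "e0 \<in> Basis" "e1 \<in> Basis" "e0 \<noteq> e1" and "z \<noteq> w"
  shows "norm (kelvin e0 e1 w l a z) \<le> norm (z - w) powr (- (2 * a - real l))"
proof -
  let ?v = "z - w"
  have pos: "norm ?v > 0" using assms by simp
  have "(norm (lin2 e0 e1 ?v))\<^sup>2 = (?v \<bullet> e0)\<^sup>2 + (?v \<bullet> e1)\<^sup>2"
    by (simp add: lin2_def cmod_power2)
  also have "\<dots> = (\<Sum>b\<in>{e0, e1}. (?v \<bullet> b)\<^sup>2)" using e by simp
  also have "\<dots> \<le> (\<Sum>b\<in>Basis. (?v \<bullet> b)\<^sup>2)" using e by (intro sum_mono2) auto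
  also have "\<dots> = (norm ?v)\<^sup>2"
    by (rule sum_Basis_square)
  finally have "norm (lin2 e0 e1 ?v) \<le> norm ?v" by (rule power2_le_imp_le) simp
  then have "norm (kelvin e0 e1 w l a z) \<le> norm ?v ^ l * norm ?v powr (- (2 * a))"
    unfolding norm_kelvin by (intro mult_right_mono power_mono) auto
  also have "\<dots> = norm ?v powr (real l + - (2 * a))"
    using pos by (simp only: powr_add powr_realpow)
  finally show ?thesis by simp
qed

lemma norm_kelvin_ge:
  assumes "(z - w) \<bullet> e0 \<ge> 0"
  shows "norm (kelvin e0 e1 w l a z) \<ge> ((z - w) \<bullet> e0) ^ l * norm (z - w) powr (- (2 * a))"
proof -
  have "(z - w) \<bullet> e0 \<le> norm (lin2 e0 e1 (z - w))"
    using complex_Re_le_cmod[of "lin2 e0 e1 (z - w)"] by (simp add: lin2_def)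
  then show ?thesis unfolding norm_kelvin using assms by (intro mult_right_mono power_mono) auto
qed

section \<open>The norm of a rapidly decaying test function\<close>

lemma nn_integral_inverse_1_plus_square_finite:
  "(\<integral>\<^sup>+x. ennreal (1 / (1 + (x::real)\<^sup>2)) \<partial>lborel) < \<infinity>"
proof -
  have "set_integrable lborel (einterval (-\<infinity>) \<infinity>) (\<lambda>x. 1 / (1 + x\<^sup>2))"
  proof (rule interval_integral_FTC_nonneg(1)[where F = arctan])
    show "((arctan \<circ> real_of_ereal) \<longlongrightarrow> - (pi / 2)) (at_right (- \<infinity>))"
      using tendsto_arctan_at_bot by (simp add: ereal_tendsto_simps)
    show "((arctan \<circ> real_of_ereal) \<longlongrightarrow> pi / 2) (at_left \<infinity>)"
      using tendsto_arctan_at_top by (simp add: ereal_tendsto_simps)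
    show "isCont (\<lambda>x. 1 / (1 + x\<^sup>2)) x" for x :: real
      by (intro continuous_intros) (metis add_pos_nonneg less_irrefl zero_le_power2 zero_less_one)
  qed (auto intro!: derivative_eq_intros simp: inverse_eq_divide)
  then have "integrable lborel (\<lambda>x::real. 1 / (1 + x\<^sup>2))"
    by (simp add: set_integrable_def)
  then show ?thesis
    by (simp add: integrable_iff_bounded)
qed

lemma nn_integral_powr_0_1_finite:
  assumes "s > -1"
  shows "(\<integral>\<^sup>+t\<in>{0..1}. ennreal ((t::real) powr s) \<partial>lborel) < \<infinity>"
  using nn_integral_has_integral_lebesgue'[OF _ has_integral_powr_from_0[OF assms, of 1]]
  by simp

definition time_axis :: "'n::finite point" where
  "time_axis = (0, 1)"

lemma time_axis_Basis [simp]: "time_axis \<in> Basis"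
  by (auto simp: time_axis_def Basis_prod_def)

lemma inner_time_axis: "z \<bullet> time_axis = snd z"
  by (cases z) (simp add: time_axis_def)

text \<open>
  The norm on the left is at least \<open>1 + t\<close>, where \<open>t\<close> is the last coordinate, and its square
  is at least \<open>1 + (z \<bullet> b)\<^sup>2\<close> for every other basis vector \<open>b\<close>. Spending a power \<open>2\<close> of it on each of the
  other coordinates bounds the integrand by a product of functions of one coordinate.
\<close>

lemma norm_shift_powr_le:
  fixes z :: "'n::finite point"
  assumes t: "snd z > 0" and q: "q \<ge> 2 * real DIM('n point) + \<bar>s\<bar> + 2"
  shows "norm (z + time_axis) powr (- q)
    \<le> (1 + snd z) powr (- (\<bar>s\<bar> + 2)) * (\<Prod>b\<in>Basis - {time_axis}. 1 / (1 + (z \<bullet> b)\<^sup>2))"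
proof -
  define R where "R = norm (z + time_axis)"
  let ?N = "card (Basis - {time_axis :: 'n point})"
  have coord: "(z + time_axis) \<bullet> time_axis = snd z + 1"
    by (simp add: inner_time_axis inner_add_left) (simp add: time_axis_def)
  have R_ge: "R \<ge> snd z + 1"
    using Basis_le_norm[OF time_axis_Basis, of "z + time_axis"] t unfolding coord R_def by simp
  have R2: "R\<^sup>2 \<ge> 1 + (z \<bullet> b)\<^sup>2" if b: "b \<in> Basis - {time_axis}" for b
  proof -
    have "1 \<le> (snd z + 1)\<^sup>2" using t by (intro one_le_power) simp
    moreover have "(z + time_axis) \<bullet> b = z \<bullet> b"
      using b time_axis_Basis inner_not_same_Basis[of time_axis b] by (auto simp: inner_add_left)
    ultimately have "1 + (z \<bullet> b)\<^sup>2 \<le> (\<Sum>c\<in>{time_axis, b}. ((z + time_axis) \<bullet> c)\<^sup>2)"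
      using b coord by (subst sum.insert) auto
    also have "\<dots> \<le> (\<Sum>c\<in>Basis. ((z + time_axis) \<bullet> c)\<^sup>2)"
      using b time_axis_Basis by (intro sum_mono2) auto
    also have "\<dots> = R\<^sup>2"
      unfolding R_def by (rule sum_Basis_square)
    finally show ?thesis .
  qed
  have "?N \<le> DIM('n point)" by (intro card_mono) auto
  then have "2 * real ?N + \<bar>s\<bar> + 2 \<le> q" using q by linarith
  then have "R powr (- q) \<le> R powr (- (\<bar>s\<bar> + 2) + (- 2) * real ?N)"
    using R_ge t by (intro powr_mono) auto
  also have "\<dots> = R powr (- (\<bar>s\<bar> + 2)) * (R powr (- 2)) ^ ?N"
    using R_ge t by (simp only: powr_add powr_powr[symmetric]) (simp add: powr_realpow)
  also have "(R powr (- 2)) ^ ?N = (\<Prod>b\<in>Basis - {time_axis :: 'n point}. 1 / R\<^sup>2)"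
    using R_ge t by (simp add: powr_minus_divide powr_numeral)
  also have "R powr (- (\<bar>s\<bar> + 2)) * \<dots>
      \<le> (1 + snd z) powr (- (\<bar>s\<bar> + 2)) * (\<Prod>b\<in>Basis - {time_axis}. 1 / (1 + (z \<bullet> b)\<^sup>2))"
  proof (intro mult_mono prod_mono conjI)
    show "R powr (- (\<bar>s\<bar> + 2)) \<le> (1 + snd z) powr (- (\<bar>s\<bar> + 2))"
      using R_ge t by (intro powr_mono2') auto
    show "1 / R\<^sup>2 \<le> 1 / (1 + (z \<bullet> b)\<^sup>2)" if "b \<in> Basis - {time_axis}" for b
      using R2[OF that] by (intro divide_left_mono) (auto simp: add_pos_nonneg intro!: mult_pos_pos less_le_trans[OF _ R2[OF that]])
  qed (auto intro!: prod_nonneg)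
  finally show ?thesis by (simp add: R_def)
qed

text \<open>
  Near \<open>0\<close> the weight \<open>t powr s\<close> dominates and is integrable for \<open>s > - 1\<close>; beyond \<open>1\<close> the
  exponent \<open>\<bar>s\<bar> + 2\<close> leaves a decay of order \<open>2\<close> whatever the sign of \<open>s\<close>.
\<close>

lemma powr_weight_le:
  fixes t :: real
  assumes "t > 0"
  shows "t powr s * (1 + t) powr (- (\<bar>s\<bar> + 2)) \<le> t powr s * indicator {0..1} t + 1 / (1 + t\<^sup>2)"
proof (cases "t \<le> 1")
  case True
  have "(1 + t) powr (- (\<bar>s\<bar> + 2)) \<le> (1 + t) powr 0"
    using assms by (intro powr_mono) auto
  then have "t powr s * (1 + t) powr (- (\<bar>s\<bar> + 2)) \<le> t powr s * 1"
    using assms by (intro mult_left_mono) auto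
  then show ?thesis using True assms by (simp add: add_increasing2)
next
  case False
  have "t powr s * (1 + t) powr (- (\<bar>s\<bar> + 2)) \<le> (1 + t) powr \<bar>s\<bar> * (1 + t) powr (- (\<bar>s\<bar> + 2))"
  proof (intro mult_right_mono)
    have "t powr s \<le> t powr \<bar>s\<bar>" using False by (intro powr_mono) auto
    also have "\<dots> \<le> (1 + t) powr \<bar>s\<bar>" using False by (intro powr_mono2) auto
    finally show "t powr s \<le> (1 + t) powr \<bar>s\<bar>" .
  qed simp
  also have "\<dots> = (1 + t) powr (- 2)" using assms by (simp flip: powr_add)
  also have "\<dots> = 1 / (1 + t)\<^sup>2" using assms by (simp add: powr_minus_divide powr_numeral)
  also have "\<dots> \<le> 1 / (1 + t\<^sup>2)"
    using assms by (intro divide_left_mono) (auto simp: power2_eq_square algebra_simps add_pos_nonneg intro!: mult_pos_pos)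
  finally show ?thesis using False by simp
qed

text \<open>
  This bounds the \<open>p\<close>-th power of the norm of a test function with pole \<open>- time_axis\<close> that decays like
  \<open>|z + time_axis|^(- q / p)\<close>. Other poles are reduced to this one by translation and scaling.
\<close>

definition model_integral :: "'n::finite point itself \<Rightarrow> real \<Rightarrow> real \<Rightarrow> ennreal" where
  "model_integral _ s q = (\<integral>\<^sup>+z. ennreal (snd (z :: 'n point) powr s * norm (z + time_axis) powr (- q))
      * indicator halfspace z \<partial>lborel)"

lemma model_integral_finite:
  assumes s: "s > -1" and q: "q \<ge> 2 * real DIM('n::finite point) + \<bar>s\<bar> + 2"
  shows "model_integral TYPE('n point) s q < \<infinity>"
proof -
  define f :: "'n point \<Rightarrow> real \<Rightarrow> ennreal" where
    "f b = (if b = time_axis then (\<lambda>t. ennreal (t powr s) * indicator {0..1} t + ennreal (1 / (1 + t\<^sup>2)))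
      else (\<lambda>x. ennreal (1 / (1 + x\<^sup>2))))" for b
  have f_meas: "f b \<in> borel_measurable borel" for b unfolding f_def by simp
  have "model_integral TYPE('n point) s q \<le> (\<integral>\<^sup>+z. (\<Prod>b\<in>Basis. f b (z \<bullet> b)) \<partial>lborel)"
    unfolding model_integral_def
  proof (rule nn_integral_mono)
    fix z :: "'n point"
    show "ennreal (snd z powr s * norm (z + time_axis) powr (- q)) * indicator halfspace z
      \<le> (\<Prod>b\<in>Basis. f b (z \<bullet> b))"
    proof (cases "z \<in> halfspace")
      case True
      then have t: "snd z > 0" by (simp add: halfspace_def)
      let ?P = "\<Prod>b\<in>Basis - {time_axis}. 1 / (1 + (z \<bullet> b)\<^sup>2)"
      have P: "?P \<ge> 0" by (intro prod_nonneg) auto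
      have "snd z powr s * norm (z + time_axis) powr (- q)
          \<le> snd z powr s * ((1 + snd z) powr (- (\<bar>s\<bar> + 2)) * ?P)"
        by (intro mult_left_mono norm_shift_powr_le t q) simp
      also have "\<dots> = (snd z powr s * (1 + snd z) powr (- (\<bar>s\<bar> + 2))) * ?P" by simp
      also have "\<dots> \<le> (snd z powr s * indicator {0..1} (snd z) + 1 / (1 + (snd z)\<^sup>2)) * ?P"
        by (intro mult_right_mono powr_weight_le t P)
      finally have "ennreal (snd z powr s * norm (z + time_axis) powr (- q))
          \<le> ennreal ((snd z powr s * indicator {0..1} (snd z) + 1 / (1 + (snd z)\<^sup>2)) * ?P)"
        by (rule ennreal_leI)
      also have "\<dots> = f time_axis (z \<bullet> time_axis) * (\<Prod>b\<in>Basis - {time_axis}. f b (z \<bullet> b))"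
        using P by (simp add: f_def inner_time_axis ennreal_mult ennreal_plus prod_ennreal ennreal_indicator cong: prod.cong_simp)
      also have "\<dots> = (\<Prod>b\<in>Basis. f b (z \<bullet> b))"
        by (rule prod.remove[symmetric]) (auto simp: time_axis_Basis)
      finally show ?thesis using True by simp
    qed simp
  qed
  also have "\<dots> = (\<Prod>b\<in>Basis. \<integral>\<^sup>+x. f b x \<partial>lborel)"
    by (rule nn_integral_lborel_prod) (auto intro: f_meas)
  also have "\<dots> < \<infinity>"
  proof -
    have "(\<integral>\<^sup>+x. f b x \<partial>lborel) < \<infinity>" for b
      using nn_integral_inverse_1_plus_square_finite nn_integral_powr_0_1_finite[OF s]
      by (cases "b = time_axis") (simp_all add: f_def nn_integral_add)
    then show ?thesis by (simp add: less_top[symmetric] ennreal_prod_eq_top)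
  qed
  finally show ?thesis .
qed

lemma nn_integral_lborel_affine:
  fixes g :: "'a::euclidean_space \<Rightarrow> ennreal"
  assumes [measurable]: "g \<in> borel_measurable borel" and c: "c > 0"
  shows "(\<integral>\<^sup>+z. g z \<partial>lborel) = ennreal (c ^ DIM('a)) * (\<integral>\<^sup>+z. g (x + c *\<^sub>R z) \<partial>lborel)"
proof -
  have "(\<integral>\<^sup>+z. g z \<partial>lborel)
      = (\<integral>\<^sup>+z. g z \<partial>density (distr lborel borel (\<lambda>z. x + c *\<^sub>R z)) (\<lambda>_. ennreal (\<bar>c\<bar> ^ DIM('a))))"
    using lborel_affine[of c x] c by simp
  also have "\<dots> = (\<integral>\<^sup>+z. ennreal (\<bar>c\<bar> ^ DIM('a)) * g (x + c *\<^sub>R z) \<partial>lborel)"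
    by (simp add: nn_integral_density nn_integral_distr)
  finally show ?thesis using c by (simp add: nn_integral_cmult)
qed

text \<open>
  The substitution \<open>z \<mapsto> (\<xi>, 0) + \<eta> *\<^sub>R z\<close> carries the pole \<open>- time_axis\<close> to \<open>(\<xi>, - \<eta>)\<close>.
\<close>

lemma nn_integral_scaled_model:
  fixes \<xi> :: "real ^ 'n::finite"
  assumes \<eta>: "\<eta> > 0"
  shows "(\<integral>\<^sup>+z. ennreal (snd z powr s * norm (z - (\<xi>, - \<eta>)) powr (- q)) * indicator halfspace z \<partial>lborel)
    = ennreal (\<eta> powr (real DIM('n point) + s - q)) * model_integral TYPE('n point) s q"
proof -
  have [measurable]: "(snd :: 'n point \<Rightarrow> real) \<in> borel_measurable borel"
    by (intro borel_measurable_continuous_onI continuous_intros)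
  have [measurable]: "halfspace \<in> sets (borel :: 'n point measure)"
    by (intro borel_open open_halfspace)
  have "(\<integral>\<^sup>+z. ennreal (snd z powr s * norm (z - (\<xi>, - \<eta>)) powr (- q)) * indicator halfspace z \<partial>lborel)
    = ennreal (\<eta> ^ DIM('n point)) * (\<integral>\<^sup>+z. ennreal (snd ((\<xi>, 0) + \<eta> *\<^sub>R z) powr s * norm ((\<xi>, 0) + \<eta> *\<^sub>R z - (\<xi>, - \<eta>)) powr (- q))
        * indicator halfspace ((\<xi>, 0) + \<eta> *\<^sub>R z) \<partial>lborel)"
    by (rule nn_integral_lborel_affine[OF _ \<eta>]) measurable
  also have "(\<integral>\<^sup>+z. ennreal (snd ((\<xi>, 0) + \<eta> *\<^sub>R z) powr s * norm ((\<xi>, 0) + \<eta> *\<^sub>R z - (\<xi>, - \<eta>)) powr (- q))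
        * indicator halfspace ((\<xi>, 0) + \<eta> *\<^sub>R z) \<partial>lborel)
     = (\<integral>\<^sup>+z. ennreal (\<eta> powr (s - q)) * (ennreal (snd z powr s * norm (z + time_axis) powr (- q))
        * indicator halfspace z) \<partial>(lborel :: 'n point measure))"
  proof (rule nn_integral_cong)
    fix z :: "'n point"
    have "(\<xi>, 0) + \<eta> *\<^sub>R z - (\<xi>, - \<eta>) = \<eta> *\<^sub>R (z + time_axis)"
      by (cases z) (simp add: time_axis_def algebra_simps)
    then have n: "norm ((\<xi>, 0) + \<eta> *\<^sub>R z - (\<xi>, - \<eta>)) = \<eta> * norm (z + time_axis)"
      using \<eta> by simp
    have t: "snd ((\<xi>, 0) + \<eta> *\<^sub>R z) = \<eta> * snd z" by simp
    show "ennreal (snd ((\<xi>, 0) + \<eta> *\<^sub>R z) powr s * norm ((\<xi>, 0) + \<eta> *\<^sub>R z - (\<xi>, - \<eta>)) powr (- q))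
        * indicator halfspace ((\<xi>, 0) + \<eta> *\<^sub>R z)
      = ennreal (\<eta> powr (s - q)) * (ennreal (snd z powr s * norm (z + time_axis) powr (- q)) * indicator halfspace z)"
      unfolding n t using \<eta>
      by (auto simp: halfspace_def indicator_def zero_less_mult_iff powr_mult powr_diff powr_minus divide_inverse
          mult_ac simp flip: ennreal_mult split: if_splits)
  qed
  also have "\<dots> = ennreal (\<eta> powr (s - q)) * model_integral TYPE('n point) s q"
    unfolding model_integral_def by (rule nn_integral_cmult) measurable
  also have "ennreal (\<eta> ^ DIM('n point)) * (ennreal (\<eta> powr (s - q)) * model_integral TYPE('n point) s q)
    = ennreal (\<eta> powr (real DIM('n point) + s - q)) * model_integral TYPE('n point) s q"
  proof -
    have "ennreal (\<eta> ^ DIM('n point)) * ennreal (\<eta> powr (s - q)) = ennreal (\<eta> ^ DIM('n point) * \<eta> powr (s - q))"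
      using \<eta> by (simp add: ennreal_mult)
    also have "\<eta> ^ DIM('n point) * \<eta> powr (s - q) = \<eta> powr (real DIM('n point) + s - q)"
      unfolding add_diff_eq[symmetric] powr_add using \<eta> by (simp only: powr_realpow)
    finally show ?thesis by (simp flip: mult.assoc)
  qed
  finally show ?thesis .
qed

section \<open>Measure bounds from test functions\<close>

lemma harmonic_on_subset: "harmonic_on S f \<Longrightarrow> T \<subseteq> S \<Longrightarrow> harmonic_on T f"
  unfolding harmonic_on_def C2_on_def by (meson continuous_on_subset subsetD)

lemma ennreal_mult_le_imp_le_inverse_mult:
  assumes "ennreal c * X \<le> Y" "c > 0"
  shows "X \<le> ennreal (1 / c) * Y"
proof -
  have "X = ennreal (1 / c) * (ennreal c * X)"
    using assms(2) by (simp add: mult.assoc[symmetric] ennreal_mult[symmetric])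
  also have "\<dots> \<le> ennreal (1 / c) * Y"
    using assms(1) by (rule mult_left_mono) simp
  finally show ?thesis .
qed

lemma ennreal_mult_le_imp_le_divide:
  assumes "ennreal c * X \<le> ennreal d" "c > 0"
  shows "X \<le> ennreal (d / c)"
  using ennreal_mult_le_imp_le_inverse_mult[OF assms] assms(2) by (simp flip: ennreal_mult')

text \<open>
  The decay exponent of the function is \<open>2 * a - l\<close>, which the assumption \<open>big\<close> makes
  large enough for the integrability of the \<open>p\<close>-th power against the weight.
\<close>

lemma kelvin_in_bergman:
  fixes \<xi> :: "real ^ 'n::finite" and e1 :: "'n point"
  assumes p: "p > 0" and s: "s > -1" and \<eta>: "\<eta> > 0"
    and e1: "e1 \<in> Basis" "e1 \<noteq> time_axis"
    and a: "2 * a = 2 * real l + real DIM('n point) - 2"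
    and big: "(2 * a - real l) * p \<ge> 2 * real DIM('n point) + \<bar>s\<bar> + 2"
  defines "f \<equiv> kelvin time_axis e1 (\<xi>, - \<eta>) l a"
  shows "f \<in> bergman p s"
    and "Lp_norm (weighted_measure s) p f powr p
      \<le> \<eta> powr (real DIM('n point) + s - (2 * a - real l) * p) * enn2real (model_integral TYPE('n point) s ((2 * a - real l) * p))"
proof -
  let ?w = "(\<xi>, - \<eta>) :: 'n point" and ?q = "(2 * a - real l) * p"
  have out: "halfspace \<subseteq> - {?w}" using \<eta> by (auto simp: halfspace_def)
  have harm: "harmonic_on halfspace f"
    unfolding f_def using harmonic_on_kelvin[OF time_axis_Basis e1(1) _ a, of ?w] e1(2)
    by (intro harmonic_on_subset[OF _ out]) auto
  have "(\<integral>\<^sup>+z. ennreal (norm (f z) powr p) \<partial>weighted_measure s)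
      = (\<integral>\<^sup>+z. ennreal (snd z powr s) * (ennreal (norm (f z) powr p) * indicator halfspace z) \<partial>lborel)"
    by (rule nn_integral_weighted_measure[OF borel_measurable_harmonic_powr(2)[OF harm]])
  also have "\<dots> \<le> (\<integral>\<^sup>+z. ennreal (snd z powr s * norm (z - ?w) powr (- ?q)) * indicator halfspace z \<partial>lborel)"
  proof (rule nn_integral_mono)
    fix z :: "'n point"
    show "ennreal (snd z powr s) * (ennreal (norm (f z) powr p) * indicator halfspace z)
      \<le> ennreal (snd z powr s * norm (z - ?w) powr (- ?q)) * indicator halfspace z"
    proof (cases "z \<in> halfspace")
      case True
      then have "norm (f z) \<le> norm (z - ?w) powr (- (2 * a - real l))"
        unfolding f_def using out e1 by (intro norm_kelvin_le time_axis_Basis) auto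
      then have "norm (f z) powr p \<le> (norm (z - ?w) powr (- (2 * a - real l))) powr p"
        using p by (intro powr_mono2) auto
      then have "norm (f z) powr p \<le> norm (z - ?w) powr (- ?q)"
        by (simp add: powr_powr algebra_simps)
      then show ?thesis
        using True by (auto simp: ennreal_mult[symmetric] intro!: ennreal_leI mult_left_mono)
    qed simp
  qed
  also have "\<dots> = ennreal (\<eta> powr (real DIM('n point) + s - ?q)) * model_integral TYPE('n point) s ?q"
    by (rule nn_integral_scaled_model[OF \<eta>])
  also have "\<dots> = ennreal (\<eta> powr (real DIM('n point) + s - ?q) * enn2real (model_integral TYPE('n point) s ?q))"
    using model_integral_finite[OF s big] by (simp add: ennreal_mult)
  finally have le: "(\<integral>\<^sup>+z. ennreal (norm (f z) powr p) \<partial>weighted_measure s)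
     \<le> ennreal (\<eta> powr (real DIM('n point) + s - ?q) * enn2real (model_integral TYPE('n point) s ?q))" .
  then have "(\<integral>\<^sup>+z. ennreal (norm (f z) powr p) \<partial>weighted_measure s) < \<infinity>"
    by (rule order.strict_trans1) simp
  then have Lp: "f \<in> Lp (weighted_measure s) p"
    using borel_measurable_harmonic_powr(1)[OF harm] by (simp add: Lp_iff borel_measurable_weighted_measure)
  then show "f \<in> bergman p s" using harm by (simp add: bergman_def)
  show "Lp_norm (weighted_measure s) p f powr p
      \<le> \<eta> powr (real DIM('n point) + s - ?q) * enn2real (model_integral TYPE('n point) s ?q)"
    using le unfolding Lp_norm_powr[OF Lp p, symmetric] by (subst (asm) ennreal_le_iff) auto
qed

text \<open>
  All \<open>m\<close> factors are the same test function \<open>f\<close> with pole \<open>(\<xi>, - \<eta>)\<close>. On \<open>D\<close> the distance to the pole is at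
  most \<open>B * \<eta>\<close> and the height above it at least \<open>\<eta>\<close>, which bounds \<open>|f|^p\<close> below by \<open>c * \<eta> powr (- q)\<close>.
  The product inequality then bounds the measure of \<open>D\<close>, and the powers \<open>\<eta> powr (- q)\<close> on the two
  sides cancel.
\<close>

lemma product_bounded_imp_emeasure_le:
  fixes s :: "'m::finite \<Rightarrow> real" and \<mu> :: "'n::finite point measure"
  assumes p: "p > 0" and s: "\<And>j. s j > -1" and B: "B > 0" and bd: "product_bounded p s \<mu>"
  obtains C where "C \<ge> 0"
    "\<And>\<xi> \<eta> D. \<eta> > 0 \<Longrightarrow> D \<in> sets \<mu> \<Longrightarrow> D \<subseteq> halfspace \<Longrightarrow> (\<And>z. z \<in> D \<Longrightarrow> norm (z - (\<xi>, - \<eta>)) \<le> B * \<eta>)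
      \<Longrightarrow> emeasure \<mu> D \<le> ennreal (C * \<eta> powr (\<Sum>j\<in>UNIV. real DIM('n point) + s j))"
proof -
  let ?N = "DIM('n point)" and ?m = "CARD('m)"
  obtain C0 where C0: "\<And>f. (\<forall>j. f j \<in> bergman p (s j)) \<Longrightarrow>
      (\<integral>\<^sup>+z. ennreal (\<Prod>j\<in>UNIV. norm (f j z) powr p) \<partial>\<mu>)
        \<le> ennreal (C0 * (\<Prod>j\<in>UNIV. Lp_norm (weighted_measure (s j)) p (f j) powr p))"
    using bd by (auto simp: product_bounded_def)
  obtain u :: "real ^ 'n" where "u \<in> Basis" using nonempty_Basis by blast
  define e1 :: "'n point" where "e1 = (u, 0)"
  have e1: "e1 \<in> Basis" "e1 \<noteq> time_axis"
    using \<open>u \<in> Basis\<close> by (auto simp: e1_def time_axis_def Basis_prod_def)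
  \<comment> \<open>The sum of the \<open>\<bar>s j\<bar>\<close> makes a single \<open>l\<close> large enough for all weights.\<close>
  define l where "l = nat \<lceil>(2 * real ?N + (\<Sum>j\<in>UNIV. \<bar>s j\<bar>) + 2) / p\<rceil>"
  define a where "a = (2 * real l + real ?N - 2) / 2"
  define q where "q = (2 * a - real l) * p"
  have N2: "real ?N \<ge> 2" by (simp add: Suc_le_eq)
  have a: "2 * a = 2 * real l + real ?N - 2" by (simp add: a_def)
  have a0: "a \<ge> 0" unfolding a_def using N2 of_nat_0_le_iff[of l] by (intro divide_nonneg_nonneg) linarith+
  have q: "q \<ge> 2 * real ?N + \<bar>s j\<bar> + 2" for j
  proof -
    have "(2 * real ?N + (\<Sum>j\<in>UNIV. \<bar>s j\<bar>) + 2) / p \<le> real l"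
      unfolding l_def by (rule real_nat_ceiling_ge)
    also have "real l \<le> 2 * a - real l" unfolding a using N2 by linarith
    finally have "2 * real ?N + (\<Sum>j\<in>UNIV. \<bar>s j\<bar>) + 2 \<le> q"
      using p by (simp add: q_def pos_divide_le_eq)
    moreover have "\<bar>s j\<bar> \<le> (\<Sum>j\<in>UNIV. \<bar>s j\<bar>)" by (rule member_le_sum) auto
    ultimately show ?thesis by linarith
  qed
  define M where "M j = enn2real (model_integral TYPE('n point) (s j) q)" for j
  define c where "c = B powr (- (2 * a * p))"
  have c: "c > 0" using B by (simp add: c_def)
  define C where "C = max C0 0 * (\<Prod>j\<in>UNIV. M j) / c ^ ?m"
  have M0: "M j \<ge> 0" for j by (simp add: M_def)
  show ?thesis
  proof (rule that[of C])
    show "C \<ge> 0" using c M0 by (simp add: C_def prod_nonneg)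
    fix \<xi> :: "real ^ 'n" and \<eta> :: real and D :: "'n point set"
    assume \<eta>: "\<eta> > 0" and D: "D \<in> sets \<mu>" "D \<subseteq> halfspace" and near: "\<And>z. z \<in> D \<Longrightarrow> norm (z - (\<xi>, - \<eta>)) \<le> B * \<eta>"
    let ?w = "(\<xi>, - \<eta>) :: 'n point"
    define f where "f = kelvin time_axis e1 ?w l a"
    have f: "f \<in> bergman p (s j)" "Lp_norm (weighted_measure (s j)) p f powr p \<le> \<eta> powr (real ?N + s j - q) * M j" for j
      using kelvin_in_bergman[OF p s \<eta> e1 a q[of j, unfolded q_def], of \<xi>] by (simp_all add: f_def q_def M_def)
    have lower: "norm (f z) powr p \<ge> c * \<eta> powr (- q)" if z: "z \<in> D" for z
    proof -
      have t: "snd z > 0" using z D by (auto simp: halfspace_def)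
      have v: "(z - ?w) \<bullet> time_axis = snd z + \<eta>" by (simp add: inner_time_axis)
      have "z \<noteq> ?w" using t \<eta> by auto
      then have pos: "norm (z - ?w) > 0" by simp
      have "\<eta> ^ l * (B * \<eta>) powr (- (2 * a)) \<le> (snd z + \<eta>) ^ l * norm (z - ?w) powr (- (2 * a))"
        using t \<eta> pos a0 near[OF z] by (intro mult_mono power_mono powr_mono2') auto
      also have "\<dots> \<le> norm (f z)"
        unfolding f_def using norm_kelvin_ge[where z = z and w = ?w and ?e0.0 = time_axis and ?e1.0 = e1 and l = l and a = a] t \<eta>
        unfolding v by simp
      finally have "(\<eta> ^ l * (B * \<eta>) powr (- (2 * a))) powr p \<le> norm (f z) powr p"
        using p \<eta> by (intro powr_mono2) auto
      also have "\<eta> ^ l * (B * \<eta>) powr (- (2 * a)) = B powr (- (2 * a)) * \<eta> powr (- (2 * a - real l))"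
        using \<eta> B by (simp add: powr_mult powr_diff powr_minus powr_realpow field_simps)
      also have "\<dots> powr p = c * \<eta> powr (- q)"
        using \<eta> B by (simp add: powr_mult powr_powr c_def q_def algebra_simps)
      finally show ?thesis .
    qed
    have c\<eta>: "c * \<eta> powr (- q) > 0" using c \<eta> by simp
    have "ennreal ((c * \<eta> powr (- q)) ^ ?m) * emeasure \<mu> D
        = (\<integral>\<^sup>+z. ennreal ((c * \<eta> powr (- q)) ^ ?m) * indicator D z \<partial>\<mu>)"
      using D by (simp add: nn_integral_cmult_indicator)
    also have "\<dots> \<le> (\<integral>\<^sup>+z. ennreal (\<Prod>j\<in>(UNIV :: 'm set). norm (f z) powr p) \<partial>\<mu>)"
    proof (rule nn_integral_mono)
      fix z
      have "(c * \<eta> powr (- q)) ^ ?m \<le> (norm (f z) powr p) ^ ?m" if "z \<in> D"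
        using lower[OF that] c\<eta> by (intro power_mono) auto
      then show "ennreal ((c * \<eta> powr (- q)) ^ ?m) * indicator D z \<le> ennreal (\<Prod>j\<in>(UNIV :: 'm set). norm (f z) powr p)"
        by (auto simp: indicator_def intro!: ennreal_leI)
    qed
    also have "\<dots> \<le> ennreal (C0 * (\<Prod>j\<in>UNIV. Lp_norm (weighted_measure (s j)) p f powr p))"
      using C0[of "\<lambda>_. f"] f(1) by simp
    also have "\<dots> \<le> ennreal (max C0 0 * (\<Prod>j\<in>UNIV. \<eta> powr (real ?N + s j - q) * M j))"
      by (intro ennreal_leI mult_mono prod_mono conjI f(2) prod_nonneg) auto
    finally have "emeasure \<mu> D \<le> ennreal (max C0 0 * (\<Prod>j\<in>UNIV. \<eta> powr (real ?N + s j - q) * M j) / (c * \<eta> powr (- q)) ^ ?m)"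
      using c\<eta> by (intro ennreal_mult_le_imp_le_divide) auto
    also have "(\<Prod>j\<in>UNIV. \<eta> powr (real ?N + s j - q) * M j)
        = (\<eta> powr (- q)) ^ ?m * \<eta> powr (\<Sum>j\<in>UNIV. real ?N + s j) * (\<Prod>j\<in>UNIV. M j)"
    proof -
      have "\<eta> powr (real ?N + s j - q) = \<eta> powr (- q) * \<eta> powr (real ?N + s j)" for j
        by (simp flip: powr_add)
      then have "(\<Prod>j\<in>UNIV. \<eta> powr (real ?N + s j - q)) = (\<eta> powr (- q)) ^ ?m * \<eta> powr (\<Sum>j\<in>UNIV. real ?N + s j)"
        using \<eta> by (simp add: prod.distrib powr_sum)
      then show ?thesis by (simp add: prod.distrib)
    qed
    also have "max C0 0 * ((\<eta> powr (- q)) ^ ?m * \<eta> powr (\<Sum>j\<in>UNIV. real ?N + s j) * (\<Prod>j\<in>UNIV. M j)) / (c * \<eta> powr (- q)) ^ ?m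
        = C * \<eta> powr (\<Sum>j\<in>UNIV. real ?N + s j)"
      using \<eta> by (simp add: C_def power_mult_distrib)
    finally show "emeasure \<mu> D \<le> ennreal (C * \<eta> powr (\<Sum>j\<in>UNIV. real ?N + s j))" .
  qed
qed

section \<open>Whitney cubes and the Carleson condition\<close>

text \<open>
  The distance of a cube to the boundary lies between \<open>a * snd (c k)\<close>, by the comparability of
  heights within the enlarged cube, and \<open>snd (c k)\<close>, which is the distance of the centre. The
  diameter lies between the side length and \<open>DIM\<close> times the side length. Hence the side lengths
  are comparable to the heights of the centres.
\<close>

lemma whitney_decomposition_sizes:
  fixes \<Delta> :: "nat \<Rightarrow> 'n::finite point set"
  assumes "whitney_decomposition \<Delta>"
  obtains c l \<alpha> \<beta> a b N where
    "\<And>k. l k > 0" "\<And>k. \<Delta> k = cube (c k) (l k)" "\<And>k. snd (c k) > 0"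
    "(\<Union>k. \<Delta> k) = halfspace" "\<And>k. cube (c k) (5 / 4 * l k) \<subseteq> halfspace"
    "\<And>z. finite {k. z \<in> cube (c k) (5 / 4 * l k)}" "\<And>z. card {k. z \<in> cube (c k) (5 / 4 * l k)} \<le> N"
    "\<alpha> > 0" "\<beta> > 0" "\<And>k. \<alpha> * snd (c k) \<le> l k" "\<And>k. l k \<le> \<beta> * snd (c k)"
    "a > 0" "b > 0" "\<And>k z. z \<in> cube (c k) (5 / 4 * l k) \<Longrightarrow> a * snd (c k) \<le> snd z \<and> snd z \<le> b * snd (c k)"
proof -
  obtain c l where W: "\<forall>k. l k > 0 \<and> \<Delta> k = cube (c k) (l k)" "(\<Union>k. \<Delta> k) = halfspace"
      "\<exists>a>0. \<exists>b>0. \<forall>k. a * setdist (\<Delta> k) (frontier halfspace) \<le> diameter (\<Delta> k) \<and>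
           diameter (\<Delta> k) \<le> b * setdist (\<Delta> k) (frontier halfspace)"
      "(\<Union>k. cube (c k) (5 / 4 * l k)) = halfspace"
      "\<exists>N. \<forall>z. finite {k. z \<in> cube (c k) (5 / 4 * l k)} \<and> card {k. z \<in> cube (c k) (5 / 4 * l k)} \<le> N"
      "\<exists>a>0. \<exists>b>0. \<forall>k. \<forall>z \<in> cube (c k) (5 / 4 * l k). a * snd (c k) \<le> snd z \<and> snd z \<le> b * snd (c k)"
    using assms unfolding whitney_decomposition_def
  proof (elim exE, goal_cases)
    case (1 c l)
    then show ?thesis by (elim conjE) (rule that)
  qed
  have lk: "\<And>k. l k > 0" and cube: "\<And>k. \<Delta> k = cube (c k) (l k)" using W(1) by blast+
  note cover = W(2) and cover' = W(4)
  obtain d e where de: "d > 0" "e > 0" "\<And>k. d * setdist (\<Delta> k) (frontier halfspace) \<le> diameter (\<Delta> k)"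
      "\<And>k. diameter (\<Delta> k) \<le> e * setdist (\<Delta> k) (frontier halfspace)" using W(3) by metis
  obtain N where N: "\<And>z. finite {k. z \<in> cube (c k) (5 / 4 * l k)}"
      "\<And>z. card {k. z \<in> cube (c k) (5 / 4 * l k)} \<le> N" using W(5) by metis
  obtain a b where ab: "a > 0" "b > 0"
      "\<And>k z. z \<in> cube (c k) (5 / 4 * l k) \<Longrightarrow> a * snd (c k) \<le> snd z \<and> snd z \<le> b * snd (c k)"
    using W(6) by metis
  let ?n = "real DIM('n point)"
  have n: "?n > 0" by simp
  have center: "c k \<in> cube (c k) (l k)" for k
    using lk[of k] by (simp add: mem_cube)
  have \<eta>: "snd (c k) > 0" for k
    using center[of k] cover cube[of k] by (auto simp: halfspace_def)
  have front: "frontier halfspace = {z :: 'n point. snd z = 0}"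
  proof -
    have "halfspace = {z :: 'n point. time_axis \<bullet> z > 0}"
      by (simp add: halfspace_def inner_time_axis inner_commute[of time_axis])
    then show ?thesis
      using frontier_halfspace_gt[of "time_axis :: 'n point" 0]
      by (simp add: inner_time_axis inner_commute[of time_axis]) (simp add: time_axis_def zero_prod_def)
  qed
  have diam: "l k \<le> diameter (\<Delta> k)" "diameter (\<Delta> k) \<le> ?n * l k" for k
  proof -
    have "\<Delta> k \<subseteq> cball (c k) (?n * (l k / 2))"
      using cube_subset_cball[of "l k / 2" "c k"] lk[of k] by (simp add: cube)
    then have "diameter (\<Delta> k) \<le> diameter (cball (c k) (?n * (l k / 2)))"
      by (rule diameter_subset) simp
    also have "\<dots> = 2 * (?n * (l k / 2))"
    proof -
      have "0 \<le> ?n * (l k / 2)" using lk[of k] by (intro mult_nonneg_nonneg) (auto intro: less_imp_le)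
      then show ?thesis unfolding diameter_cball by (simp only: not_less[symmetric] if_False)
    qed
    finally show "diameter (\<Delta> k) \<le> ?n * l k" by simp
    let ?x = "c k - (l k / 2) *\<^sub>R time_axis" and ?y = "c k + (l k / 2) *\<^sub>R time_axis"
    have "?x \<in> \<Delta> k" "?y \<in> \<Delta> k"
      using lk[of k] time_axis_Basis
      by (auto simp: cube mem_cube inner_diff_left inner_add_left inner_Basis)
    moreover have "bounded (\<Delta> k)" by (simp add: cube cube_def)
    ultimately have "dist ?x ?y \<le> diameter (\<Delta> k)" by (intro diameter_bounded_bound)
    also have "dist ?x ?y = l k"
    proof -
      have "?x - ?y = (- l k) *\<^sub>R time_axis" by (simp add: scaleR_left_diff_distrib[symmetric] algebra_simps flip: scaleR_add_left)
      then show ?thesis using lk[of k] time_axis_Basis by (simp add: dist_norm)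
    qed
    finally show "l k \<le> diameter (\<Delta> k)" .
  qed
  have upper: "l k \<le> e * snd (c k)" for k
  proof -
    have "setdist (\<Delta> k) (frontier halfspace) \<le> dist (c k) (fst (c k), 0)"
      using center[of k] by (intro setdist_le_dist) (auto simp: cube front)
    also have "\<dots> = snd (c k)"
      using \<eta>[of k] by (cases "c k") (simp add: dist_norm norm_Pair)
    finally have "e * setdist (\<Delta> k) (frontier halfspace) \<le> e * snd (c k)"
      using de by simp
    then show ?thesis using diam(1)[of k] de(4)[of k] by linarith
  qed
  have lower: "(d * a / ?n) * snd (c k) \<le> l k" for k
  proof -
    have sub: "cube (c k) (l k) \<subseteq> cube (c k) (5 / 4 * l k)"
      using lk[of k] by (force simp: mem_cube)
    have "a * snd (c k) \<le> setdist (\<Delta> k) (frontier halfspace)"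
    proof (rule le_setdistI)
      show "\<Delta> k \<noteq> {}" using center cube by blast
      show "frontier (halfspace :: 'n point set) \<noteq> {}" unfolding front by (auto intro!: exI[of _ 0])
      fix x y assume x: "x \<in> \<Delta> k" and y: "y \<in> frontier (halfspace :: 'n point set)"
      have "a * snd (c k) \<le> snd x" using ab(3)[of x k] x sub by (auto simp: cube)
      also have "\<dots> \<le> dist x y"
        using dist_snd_le[of x y] y by (simp add: front dist_real_def)
      finally show "a * snd (c k) \<le> dist x y" .
    qed
    then have "d * (a * snd (c k)) \<le> ?n * l k"
      using de(1) de(3)[of k] diam(2)[of k] by (smt (verit) mult_left_mono)
    then show ?thesis using n by (simp add: field_simps)
  qed
  show ?thesis
    by (rule that[of l c N "d * a / ?n" e a b])
      (use lk cube \<eta> cover cover' N de ab upper lower n in \<open>auto\<close>)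
qed

text \<open>
  A cube of side \<open>l\<close> has Lebesgue measure \<open>l\<close> to the power \<open>n + 1\<close>, so the exponent in the Carleson condition
  turns into \<open>\<Sum>j. (n + 1) + s j\<close> as an exponent of \<open>l\<close>. The constant may be taken nonnegative
  because \<open>ennreal\<close> sends negative numbers to \<open>0\<close>.
\<close>

lemma carleson_iff:
  fixes s :: "'m::finite \<Rightarrow> real" and \<mu> :: "'n::finite point measure"
  assumes lk: "\<And>k. l k > 0" and cube: "\<And>k. \<Delta> k = cube (c k) (l k)"
  shows "carleson \<Delta> s \<mu> \<longleftrightarrow>
    (\<exists>C\<ge>0. \<forall>k. emeasure \<mu> (\<Delta> k) \<le> ennreal (C * l k powr (\<Sum>j\<in>UNIV. real DIM('n point) + s j)))"
proof -
  let ?E = "\<Sum>j\<in>UNIV. real DIM('n point) + s j"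
  have size: "measure lborel (\<Delta> k) powr (real CARD('m) + 1 / (real CARD('n) + 1) * (\<Sum>j\<in>UNIV. s j)) = l k powr ?E" for k
  proof -
    have "measure lborel (\<Delta> k) = l k powr (real CARD('n) + 1)"
      using lk[of k] by (simp add: cube content_cube powr_add powr_realpow less_imp_le)
    moreover have "(real CARD('n) + 1) * (real CARD('m) + 1 / (real CARD('n) + 1) * (\<Sum>j\<in>UNIV. s j)) = ?E"
    proof -
      have "real CARD('n) + 1 \<noteq> 0" by linarith
      then show ?thesis by (simp add: sum.distrib field_simps)
    qed
    ultimately show ?thesis by (simp only: powr_powr)
  qed
  have iff: "emeasure \<mu> (\<Delta> k) / ennreal (l k powr ?E) \<le> ennreal C
      \<longleftrightarrow> emeasure \<mu> (\<Delta> k) \<le> ennreal C * ennreal (l k powr ?E)" for C k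
  proof -
    have x: "l k powr ?E > 0" using lk[of k] by simp
    have "emeasure \<mu> (\<Delta> k) / ennreal (l k powr ?E) \<le> ennreal C" if "emeasure \<mu> (\<Delta> k) \<le> ennreal C * ennreal (l k powr ?E)"
      using that x by (intro divide_le_posI_ennreal) (auto simp: mult.commute)
    moreover have "emeasure \<mu> (\<Delta> k) \<le> ennreal C * ennreal (l k powr ?E)" if "emeasure \<mu> (\<Delta> k) / ennreal (l k powr ?E) \<le> ennreal C"
    proof -
      have "emeasure \<mu> (\<Delta> k) = emeasure \<mu> (\<Delta> k) / ennreal (l k powr ?E) * ennreal (l k powr ?E)"
        using x by (simp add: ennreal_divide_times ennreal_mult_divide_eq)
      also have "\<dots> \<le> ennreal C * ennreal (l k powr ?E)" using that by (rule mult_right_mono) simp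
      finally show ?thesis .
    qed
    ultimately show ?thesis by blast
  qed
  show ?thesis
    unfolding carleson_def size iff
  proof
    assume "\<exists>C. \<forall>k. emeasure \<mu> (\<Delta> k) \<le> ennreal C * ennreal (l k powr ?E)"
    then obtain C where C: "\<And>k. emeasure \<mu> (\<Delta> k) \<le> ennreal C * ennreal (l k powr ?E)" by blast
    have "ennreal C = ennreal (max C 0)" by (simp add: max_def ennreal_neg)
    then show "\<exists>C\<ge>0. \<forall>k. emeasure \<mu> (\<Delta> k) \<le> ennreal (C * l k powr ?E)"
      using C by (intro exI[of _ "max C 0"]) (simp add: ennreal_mult)
  next
    assume "\<exists>C\<ge>0. \<forall>k. emeasure \<mu> (\<Delta> k) \<le> ennreal (C * l k powr ?E)"
    then show "\<exists>C. \<forall>k. emeasure \<mu> (\<Delta> k) \<le> ennreal C * ennreal (l k powr ?E)"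
      by (metis ennreal_mult powr_ge_zero)
  qed
qed

lemma sum_DIM_plus_pos:
  assumes "\<And>j. s j > -1"
  shows "(\<Sum>j\<in>(UNIV :: 'm::finite set). real DIM('n::finite point) + s j) > 0"
proof (rule sum_pos)
  fix j
  have "real DIM('n point) \<ge> 1" using DIM_positive[where 'a="'n point"] by linarith
  then show "real DIM('n point) + s j > 0" using assms[of j] by linarith
qed auto

text \<open>
  The cube \<open>\<Delta> k\<close> plays the role of \<open>D\<close>, and \<open>\<xi>\<close>, \<open>\<eta>\<close> are the coordinates of its centre. The
  passage from \<open>\<eta>\<close> to the side length uses that the exponent is positive.
\<close>

lemma product_bounded_imp_carleson:
  fixes s :: "'m::finite \<Rightarrow> real" and \<mu> :: "'n::finite point measure"
  assumes p: "p > 0" and s: "\<And>j. s j > -1" and sets: "sets \<mu> = sets (restrict_space borel halfspace)"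
    and W: "whitney_decomposition \<Delta>" and bd: "product_bounded p s \<mu>"
  shows "carleson \<Delta> s \<mu>"
  using W
proof (rule whitney_decomposition_sizes)
  fix c l \<alpha> \<beta> a b N
  assume lk: "\<And>k. l k > 0" and cube: "\<And>k. \<Delta> k = cube (c k) (l k)" and \<eta>: "\<And>k. snd (c k) > 0"
    and cover: "(\<Union>k. \<Delta> k) = halfspace"
    and \<alpha>: "\<alpha> > 0" "\<And>k. \<alpha> * snd (c k) \<le> l k" and \<beta>: "\<beta> > 0" "\<And>k. l k \<le> \<beta> * snd (c k)"
  let ?E = "\<Sum>j\<in>UNIV. real DIM('n point) + s j" and ?n = "real DIM('n point)"
  have E: "?E > 0" using s by (rule sum_DIM_plus_pos)
  have "?n * \<beta> / 2 + 2 > 0" using \<beta> by (simp add: add_pos_pos)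
  then obtain C where C: "C \<ge> 0" and le: "\<And>\<xi> \<eta> D. \<eta> > 0 \<Longrightarrow> D \<in> sets \<mu> \<Longrightarrow> D \<subseteq> halfspace \<Longrightarrow>
      (\<And>z. z \<in> D \<Longrightarrow> norm (z - (\<xi>, - \<eta>)) \<le> (?n * \<beta> / 2 + 2) * \<eta>) \<Longrightarrow> emeasure \<mu> D \<le> ennreal (C * \<eta> powr ?E)"
    using product_bounded_imp_emeasure_le[OF p s _ bd] by blast
  have "emeasure \<mu> (\<Delta> k) \<le> ennreal (C * (1 / \<alpha>) powr ?E * l k powr ?E)" for k
  proof -
    have sub: "\<Delta> k \<subseteq> halfspace" using cover by blast
    have "closed (\<Delta> k)" by (simp add: cube cube_def closed_cbox)
    then have "\<Delta> k \<in> sets \<mu>"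
      using sub unfolding sets by (auto simp: sets_restrict_space intro!: image_eqI[of _ _ "\<Delta> k"])
    moreover have "norm (z - (fst (c k), - snd (c k))) \<le> (?n * \<beta> / 2 + 2) * snd (c k)" if z: "z \<in> \<Delta> k" for z
    proof -
      have "norm (z - c k) \<le> ?n * (l k / 2)"
        using cube_subset_cball[of "l k / 2" "c k"] z lk[of k]
        by (auto simp: cube dist_norm norm_minus_commute)
      also have "\<dots> \<le> ?n * (\<beta> * snd (c k) / 2)"
        using \<beta>(2)[of k] by (intro mult_left_mono) auto
      finally have "norm (z - c k) \<le> ?n * \<beta> / 2 * snd (c k)" by simp
      moreover have "norm (c k - (fst (c k), - snd (c k))) = 2 * snd (c k)"
      proof -
        have "c k - (fst (c k), - snd (c k)) = (2 * snd (c k)) *\<^sub>R time_axis"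
          by (cases "c k") (simp add: time_axis_def)
        then show ?thesis using \<eta>[of k] time_axis_Basis by simp
      qed
      moreover have "norm (z - (fst (c k), - snd (c k))) \<le> norm (z - c k) + norm (c k - (fst (c k), - snd (c k)))"
        using dist_triangle[of z "(fst (c k), - snd (c k))" "c k"] by (simp only: dist_norm)
      ultimately show ?thesis unfolding distrib_right by linarith
    qed
    ultimately have "emeasure \<mu> (\<Delta> k) \<le> ennreal (C * snd (c k) powr ?E)"
      using sub \<eta>[of k] by (intro le) auto
    also have "\<dots> \<le> ennreal (C * (1 / \<alpha> * l k) powr ?E)"
      using C E \<alpha>(1) \<alpha>(2)[of k] \<eta>[of k]
      by (intro ennreal_leI mult_left_mono powr_mono2) (auto simp: field_simps)
    also have "\<dots> = ennreal (C * (1 / \<alpha>) powr ?E * l k powr ?E)"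
      using \<alpha> lk[of k] by (simp add: powr_mult powr_divide)
    finally show ?thesis .
  qed
  then show "carleson \<Delta> s \<mu>"
    unfolding carleson_iff[OF lk cube]
    using C by (intro exI[of _ "C * (1 / \<alpha>) powr ?E"]) auto
qed

section \<open>From the Carleson condition to the trace inequality\<close>

lemma powr_ge_of_comparable:
  fixes x y :: real
  assumes "a > 0" "b > 0" "y > 0" "a * y \<le> x" "x \<le> b * y"
  shows "min (a powr s) (b powr s) * y powr s \<le> x powr s"
proof (cases "s \<ge> 0")
  case True
  have "(a * y) powr s \<le> x powr s" using assms True by (intro powr_mono2) auto
  then show ?thesis
    using assms by (auto simp: powr_mult intro: order_trans[OF mult_right_mono[OF min.cobounded1]])
next
  case False
  have "x > 0" using assms by (meson less_le_trans mult_pos_pos)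
  then have "(b * y) powr s \<le> x powr s" using assms False by (intro powr_mono2') auto
  then show ?thesis
    using assms by (auto simp: powr_mult intro: order_trans[OF mult_right_mono[OF min.cobounded2]])
qed

lemma sum_indicator_le:
  fixes Q :: "nat \<Rightarrow> 'a set"
  assumes "finite {k. x \<in> Q k}" "card {k. x \<in> Q k} \<le> N"
  shows "(\<Sum>k. indicator (Q k) x :: ennreal) \<le> of_nat N"
proof -
  have "(\<Sum>k. indicator (Q k) x :: ennreal) = (\<Sum>k\<in>{k. x \<in> Q k}. indicator (Q k) x)"
    using assms(1) by (rule suminf_finite) simp
  also have "\<dots> = of_nat (card {k. x \<in> Q k})" by simp
  also have "\<dots> \<le> of_nat N" using assms(2) by simp
  finally show ?thesis .
qed

lemma suminf_nn_integral_overlap_le: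
  assumes h [measurable]: "h \<in> borel_measurable M"
    and Q [measurable]: "\<And>k. Q k \<inter> space M \<in> sets M"
    and N: "\<And>x. finite {k. x \<in> Q k}" "\<And>x. card {k. x \<in> Q k} \<le> N"
  shows "(\<Sum>k::nat. \<integral>\<^sup>+x. h x * indicator (Q k) x \<partial>M) \<le> of_nat N * (\<integral>\<^sup>+x. h x \<partial>M)"
proof -
  have [measurable]: "(indicator (Q k) :: _ \<Rightarrow> ennreal) \<in> borel_measurable M" for k
    using Q by (simp add: borel_measurable_indicator_iff)
  have "(\<Sum>k. \<integral>\<^sup>+x. h x * indicator (Q k) x \<partial>M) = (\<integral>\<^sup>+x. (\<Sum>k. h x * indicator (Q k) x) \<partial>M)"
    by (rule nn_integral_suminf[symmetric]) measurable
  also have "\<dots> = (\<integral>\<^sup>+x. h x * (\<Sum>k. indicator (Q k) x) \<partial>M)" by simp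
  also have "\<dots> \<le> (\<integral>\<^sup>+x. of_nat N * h x \<partial>M)"
    by (intro nn_integral_mono) (subst mult.commute, intro mult_right_mono sum_indicator_le N, simp)
  also have "\<dots> = of_nat N * (\<integral>\<^sup>+x. h x \<partial>M)" by (rule nn_integral_cmult) measurable
  finally show ?thesis .
qed

lemma nn_integral_le_suminf_cover:
  assumes h [measurable]: "h \<in> borel_measurable M" and D [measurable]: "\<And>k. D k \<in> sets M"
    and cover: "space M \<subseteq> (\<Union>k. D k)"
  shows "(\<integral>\<^sup>+x. h x \<partial>M) \<le> (\<Sum>k::nat. \<integral>\<^sup>+x. h x * indicator (D k) x \<partial>M)"
proof -
  have "(\<integral>\<^sup>+x. h x \<partial>M) \<le> (\<integral>\<^sup>+x. (\<Sum>k. h x * indicator (D k) x) \<partial>M)"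
  proof (rule nn_integral_mono)
    fix x assume "x \<in> space M"
    then obtain k where k: "x \<in> D k" using cover by blast
    have "h x = (\<Sum>k\<in>{k}. h x * indicator (D k) x)" using k by simp
    also have "\<dots> \<le> (\<Sum>k. h x * indicator (D k) x)" by (rule sum_le_suminf) auto
    finally show "h x \<le> (\<Sum>k. h x * indicator (D k) x)" .
  qed
  also have "\<dots> = (\<Sum>k. \<integral>\<^sup>+x. h x * indicator (D k) x \<partial>M)"
    by (rule nn_integral_suminf) measurable
  finally show ?thesis .
qed

text \<open>
  \<open>Q k\<close> is the \<open>m\<close>-th power of the enlarged cube. The proof estimates the contribution of \<open>\<Delta> k\<close>
  by the weighted integral \<open>A k\<close> over \<open>Q k\<close> with a constant \<open>B\<close> independent of \<open>k\<close>, and sums over \<open>k\<close>.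
\<close>

lemma carleson_imp_trace_bounded:
  fixes s :: "'m::finite \<Rightarrow> real" and \<mu> :: "'n::finite point measure"
  assumes p: "p > 0" and sets: "sets \<mu> = sets (restrict_space borel halfspace)"
    and W: "whitney_decomposition \<Delta>" and carl: "carleson \<Delta> s \<mu>"
  shows "trace_bounded (bergman_pow p s) p s \<mu>"
  using W
proof (rule whitney_decomposition_sizes)
  fix c l \<alpha> \<beta> a b N
  assume lk: "\<And>k. l k > 0" and cube: "\<And>k. \<Delta> k = cube (c k) (l k)" and \<eta>: "\<And>k. snd (c k) > 0"
    and cover: "(\<Union>k. \<Delta> k) = halfspace" and large: "\<And>k. cube (c k) (5 / 4 * l k) \<subseteq> halfspace"
    and N: "\<And>z. finite {k. z \<in> cube (c k) (5 / 4 * l k)}" "\<And>z. card {k. z \<in> cube (c k) (5 / 4 * l k)} \<le> N"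
    and \<alpha>: "\<alpha> > 0" "\<And>k. \<alpha> * snd (c k) \<le> l k" and \<beta>: "\<beta> > 0" "\<And>k. l k \<le> \<beta> * snd (c k)"
    and ab: "a > 0" "b > 0" "\<And>k z. z \<in> cube (c k) (5 / 4 * l k) \<Longrightarrow> a * snd (c k) \<le> snd z \<and> snd z \<le> b * snd (c k)"
  let ?V = "DIM('n point ^ 'm)" and ?\<sigma> = "\<Sum>j\<in>UNIV. s j"
  let ?M = "weighted_measure_pow s :: ('n point ^ 'm) measure"
  obtain C where C: "C \<ge> 0" and \<mu>: "\<And>k. emeasure \<mu> (\<Delta> k) \<le> ennreal (C * l k powr (\<Sum>j\<in>UNIV. real DIM('n point) + s j))"
    using carl unfolding carleson_iff[OF lk cube] by blast
  obtain K where K: "K > 0" and avg: "\<And>(f :: 'n point ^ 'm \<Rightarrow> complex) \<Omega> c r. open \<Omega> \<Longrightarrow> harmonic_on \<Omega> f \<Longrightarrow> r > 0 \<Longrightarrow> cube c (2 * r) \<subseteq> \<Omega> \<Longrightarrow>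
     ennreal (norm (f c) powr p)
       \<le> ennreal (K / r ^ ?V) * (\<integral>\<^sup>+x\<in>cube c (2 * r). ennreal (norm (f x) powr p) \<partial>lborel)"
    using norm_powr_le_cube_average[OF p, where 'a = "'n point ^ 'm"] by blast
  define \<gamma> where "\<gamma> = (\<Prod>j\<in>UNIV. min (a powr s j) (b powr s j))"
  have \<gamma>: "\<gamma> > 0" using ab by (simp add: \<gamma>_def prod_pos)
  define \<theta> where "\<theta> = min (\<alpha> powr (- ?\<sigma>)) (\<beta> powr (- ?\<sigma>))"
  have \<theta>: "\<theta> > 0" using \<alpha> \<beta> by (simp add: \<theta>_def)
  define Q :: "nat \<Rightarrow> ('n point ^ 'm) set" where "Q k = {Z. \<forall>j. Z $ j \<in> cube (c k) (5 / 4 * l k)}" for k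
  have Q_half: "Q k \<subseteq> halfspace_pow" for k
    using large[of k] by (auto simp: Q_def halfspace_pow_def)
  have Q_closed: "closed (Q k)" for k
  proof -
    have "closed ((\<lambda>Z :: 'n point ^ 'm. Z $ j) -` cube (c k) (5 / 4 * l k))" for j
      unfolding cube_def by (intro continuous_closed_vimage closed_cbox continuous_intros)
    then have "closed (\<Inter>j. (\<lambda>Z :: 'n point ^ 'm. Z $ j) -` cube (c k) (5 / 4 * l k))" by auto
    moreover have "(\<Inter>j. (\<lambda>Z :: 'n point ^ 'm. Z $ j) -` cube (c k) (5 / 4 * l k)) = Q k"
      by (auto simp: Q_def)
    ultimately show ?thesis by simp
  qed
  have Q_sets: "Q k \<inter> space ?M \<in> sets ?M" for k
    using Q_closed[of k] open_halfspace_pow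
    by (auto simp: weighted_measure_pow_def sets_restrict_space space_restrict_space Int_commute intro!: image_eqI[of _ _ "Q k"])
  have Q_overlap: "finite {k. Z \<in> Q k}" "card {k. Z \<in> Q k} \<le> N" for Z
  proof -
    \<comment> \<open>A single coordinate of \<open>Z\<close> already determines which enlarged cubes are possible.\<close>
    have sub: "{k. Z \<in> Q k} \<subseteq> {k. Z $ undefined \<in> cube (c k) (5 / 4 * l k)}" by (auto simp: Q_def)
    then show "finite {k. Z \<in> Q k}" using N(1) by (rule finite_subset)
    show "card {k. Z \<in> Q k} \<le> N" using card_mono[OF N(1) sub] N(2) by (rule order_trans)
  qed
  \<comment> \<open>On \<open>Q k\<close> each weight is comparable to a power of the height of the centre; the minimum in \<open>\<gamma>\<close>
      covers both signs of the exponents.\<close>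
  have weight: "\<gamma> * snd (c k) powr ?\<sigma> \<le> (\<Prod>j\<in>UNIV. snd (Z $ j) powr s j)" if Z: "Z \<in> Q k" for k Z
  proof -
    have "\<gamma> * snd (c k) powr ?\<sigma> = (\<Prod>j\<in>UNIV. min (a powr s j) (b powr s j) * snd (c k) powr s j)"
      using \<eta>[of k] by (simp add: \<gamma>_def prod.distrib powr_sum)
    also have "\<dots> \<le> (\<Prod>j\<in>UNIV. snd (Z $ j) powr s j)"
      using Z ab \<eta>[of k] by (intro prod_mono conjI powr_ge_of_comparable) (auto simp: Q_def)
    finally show ?thesis .
  qed
  define B where "B = C * K * 8 ^ ?V / (\<gamma> * \<theta>)"
  have B: "B \<ge> 0" using C K \<gamma> \<theta> by (simp add: B_def)
  show "trace_bounded (bergman_pow p s) p s \<mu>"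
  proof (rule trace_boundedI[OF p])
    show "B * real N \<ge> 0" using B by simp
    show "bergman_pow p s \<subseteq> Lp ?M p" by (auto simp: bergman_pow_def)
    fix f :: "'n point ^ 'm \<Rightarrow> complex" assume f: "f \<in> bergman_pow p s"
    then have harm: "harmonic_on halfspace_pow f" by (simp add: bergman_pow_def)
    have "continuous_on halfspace (Tr f)"
      unfolding Tr_def
      by (intro continuous_on_compose2[OF harmonic_on_imp_continuous_on[OF harm]] continuous_intros)
        (auto simp: halfspace_pow_def)
    then have "Tr f \<in> borel_measurable (restrict_space borel halfspace)"
      by (rule borel_measurable_continuous_on_restrict)
    then show meas [measurable]: "Tr f \<in> borel_measurable \<mu>"
      by (simp add: measurable_cong_sets[OF sets refl])
    let ?h = "\<lambda>Z. ennreal (norm (f Z) powr p)"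
    have h_meas: "?h \<in> borel_measurable ?M"
      using borel_measurable_harmonic_powr(2)[OF harm] by (simp add: borel_measurable_weighted_measure_pow)
    define A where "A k = (\<integral>\<^sup>+Z. ?h Z * indicator (Q k) Z \<partial>?M)" for k
    have lebesgue_le: "(\<integral>\<^sup>+Z\<in>Q k. ?h Z \<partial>lborel) \<le> ennreal (1 / (\<gamma> * snd (c k) powr ?\<sigma>)) * A k" for k
    proof -
      let ?w = "\<lambda>Z :: 'n point ^ 'm. \<Prod>j\<in>UNIV. snd (Z $ j) powr s j" and ?x = "\<gamma> * snd (c k) powr ?\<sigma>"
      have x: "?x > 0" using \<gamma> \<eta>[of k] by simp
      have Qmeas: "(\<lambda>Z. ?h Z * indicator (Q k) Z) \<in> borel_measurable (restrict_space borel halfspace_pow)"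
        using Q_closed[of k]
        by (intro borel_measurable_times_ennreal borel_measurable_harmonic_powr(2)[OF harm]
            measurable_restrict_space1[OF borel_measurable_indicator]) auto
      have hQ: "(\<lambda>Z. ?h Z * indicator (Q k) Z * indicator halfspace_pow Z) \<in> borel_measurable borel"
        using Qmeas open_halfspace_pow
        by (subst borel_measurable_restrict_space_iff_ennreal[symmetric]) (auto intro: borel_open)
      have "(\<integral>\<^sup>+Z\<in>Q k. ?h Z \<partial>lborel) = (\<integral>\<^sup>+Z. ?h Z * indicator (Q k) Z * indicator halfspace_pow Z \<partial>lborel)"
        using Q_half[of k] by (intro nn_integral_cong) (auto simp: indicator_def)
      then have "ennreal ?x * (\<integral>\<^sup>+Z\<in>Q k. ?h Z \<partial>lborel)
          = (\<integral>\<^sup>+Z. ennreal ?x * (?h Z * indicator (Q k) Z * indicator halfspace_pow Z) \<partial>lborel)"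
        using nn_integral_cmult[of "\<lambda>Z. ?h Z * indicator (Q k) Z * indicator halfspace_pow Z" lborel "ennreal ?x"] hQ
        by simp
      also have "\<dots> \<le> (\<integral>\<^sup>+Z. ennreal (?w Z) * (?h Z * indicator (Q k) Z * indicator halfspace_pow Z) \<partial>lborel)"
        using weight[of _ k] by (intro nn_integral_mono) (auto simp: indicator_def intro!: mult_right_mono ennreal_leI)
      also have "\<dots> = A k"
        unfolding A_def by (rule nn_integral_weighted_measure_pow[OF Qmeas, symmetric])
      finally have "ennreal ?x * (\<integral>\<^sup>+Z\<in>Q k. ?h Z \<partial>lborel) \<le> A k" .
      then show ?thesis using x by (rule ennreal_mult_le_imp_le_inverse_mult)
    qed
    have point_le: "ennreal (norm (Tr f z) powr p) \<le> ennreal (K / (l k / 8) ^ ?V) * (\<integral>\<^sup>+Z\<in>Q k. ?h Z \<partial>lborel)"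
      if z: "z \<in> \<Delta> k" for z k
    proof -
      let ?Z = "(\<chi> j. z) :: 'n point ^ 'm"
      \<comment> \<open>The half-sides of the cube and of its enlargement are \<open>l k / 2\<close> and \<open>5 * l k / 8\<close>,
      which leaves the margin \<open>l k / 8\<close>.\<close>
      have sub: "cube ?Z (2 * (l k / 8)) \<subseteq> Q k"
      proof
        fix W assume W: "W \<in> cube ?Z (2 * (l k / 8))"
        have "\<bar>W $ j \<bullet> u - c k \<bullet> u\<bar> \<le> 5 / 4 * l k / 2" if u: "u \<in> Basis" for j u
        proof -
          have "axis j u \<in> Basis" using u by (auto simp: Basis_vec_def)
          then have "\<bar>W \<bullet> axis j u - ?Z \<bullet> axis j u\<bar> \<le> 2 * (l k / 8) / 2"
            using W unfolding mem_cube by blast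
          then have "\<bar>W $ j \<bullet> u - z \<bullet> u\<bar> \<le> 2 * (l k / 8) / 2"
            by (simp add: inner_axis)
          moreover have "\<bar>z \<bullet> u - c k \<bullet> u\<bar> \<le> l k / 2"
            using z u by (simp add: cube mem_cube)
          ultimately show ?thesis by linarith
        qed
        then show "W \<in> Q k" by (simp add: Q_def mem_cube)
      qed
      have "ennreal (norm (f ?Z) powr p)
          \<le> ennreal (K / (l k / 8) ^ ?V) * (\<integral>\<^sup>+Z\<in>cube ?Z (2 * (l k / 8)). ?h Z \<partial>lborel)"
        using sub Q_half[of k] lk[of k] by (intro avg[OF open_halfspace_pow harm]) auto
      also have "\<dots> \<le> ennreal (K / (l k / 8) ^ ?V) * (\<integral>\<^sup>+Z\<in>Q k. ?h Z \<partial>lborel)"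
        using sub by (intro mult_left_mono nn_integral_mono) (auto simp: indicator_def)
      finally show ?thesis by (simp add: Tr_def)
    qed
    have cube_le: "(\<integral>\<^sup>+z. ennreal (norm (Tr f z) powr p) * indicator (\<Delta> k) z \<partial>\<mu>) \<le> ennreal B * A k" for k
    proof -
      let ?E = "\<Sum>j\<in>(UNIV :: 'm set). real DIM('n point) + s j"
      define G where "G = K / (l k / 8) ^ ?V * (1 / (\<gamma> * snd (c k) powr ?\<sigma>))"
      have G: "G \<ge> 0" using K \<gamma> lk[of k] by (simp add: G_def)
      have "\<Delta> k \<subseteq> halfspace" using cover by blast
      moreover have "closed (\<Delta> k)" by (simp add: cube cube_def closed_cbox)
      ultimately have \<Delta>: "\<Delta> k \<in> sets \<mu>"
        unfolding sets by (auto simp: sets_restrict_space intro!: image_eqI[of _ _ "\<Delta> k"])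
      have "ennreal (norm (Tr f z) powr p) \<le> ennreal G * A k" if "z \<in> \<Delta> k" for z
      proof -
        have "ennreal (norm (Tr f z) powr p) \<le> ennreal (K / (l k / 8) ^ ?V) * (ennreal (1 / (\<gamma> * snd (c k) powr ?\<sigma>)) * A k)"
          using point_le[OF that] by (rule order_trans) (intro mult_left_mono lebesgue_le, simp)
        also have "\<dots> = ennreal G * A k"
          using K lk[of k] \<gamma> by (simp only: G_def mult.assoc[symmetric]) (subst ennreal_mult, auto)
        finally show ?thesis .
      qed
      then have "(\<integral>\<^sup>+z. ennreal (norm (Tr f z) powr p) * indicator (\<Delta> k) z \<partial>\<mu>) \<le> (\<integral>\<^sup>+z. (ennreal G * A k) * indicator (\<Delta> k) z \<partial>\<mu>)"
        by (intro nn_integral_mono) (auto simp: indicator_def)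
      also have "\<dots> = ennreal G * A k * emeasure \<mu> (\<Delta> k)" using \<Delta> by (rule nn_integral_cmult_indicator)
      also have "\<dots> \<le> ennreal G * A k * ennreal (C * l k powr ?E)"
        by (intro mult_left_mono \<mu>) simp
      also have "\<dots> = ennreal (G * (C * l k powr ?E)) * A k"
        using G C by (simp add: ennreal_mult mult_ac)
      also have "\<dots> \<le> ennreal B * A k"
      proof (intro mult_right_mono ennreal_leI)
        have "?E = real ?V + ?\<sigma>" by (simp add: sum.distrib algebra_simps)
        then have lE: "l k powr ?E = l k ^ ?V * l k powr ?\<sigma>"
          using lk[of k] by (simp only: powr_add powr_realpow)
        have "\<theta> * snd (c k) powr (- ?\<sigma>) \<le> l k powr (- ?\<sigma>)"
          unfolding \<theta>_def using \<alpha> \<beta> \<eta> by (intro powr_ge_of_comparable) auto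
        then have ratio: "l k powr ?\<sigma> / snd (c k) powr ?\<sigma> \<le> 1 / \<theta>"
          using lk[of k] \<eta>[of k] \<theta> by (simp add: powr_minus field_simps)
        have "G * (C * l k powr ?E) = (C * K * 8 ^ ?V / \<gamma>) * (l k powr ?\<sigma> / snd (c k) powr ?\<sigma>)"
          unfolding lE G_def using lk[of k] by (simp add: power_divide)
        also have "\<dots> \<le> (C * K * 8 ^ ?V / \<gamma>) * (1 / \<theta>)"
          using ratio C K \<gamma> by (intro mult_left_mono) auto
        also have "\<dots> = B" by (simp add: B_def)
        finally show "G * (C * l k powr ?E) \<le> B" .
      qed simp
      finally show ?thesis .
    qed
    have "(\<integral>\<^sup>+z. ennreal (norm (Tr f z) powr p) \<partial>\<mu>)
        \<le> (\<Sum>k. \<integral>\<^sup>+z. ennreal (norm (Tr f z) powr p) * indicator (\<Delta> k) z \<partial>\<mu>)"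
    proof (rule nn_integral_le_suminf_cover)
      show "space \<mu> \<subseteq> (\<Union>k. \<Delta> k)"
        using sets_eq_imp_space_eq[OF sets] cover by (simp add: space_restrict_space)
      fix k
      have "\<Delta> k \<subseteq> halfspace" using cover by blast
      moreover have "closed (\<Delta> k)" by (simp add: cube cube_def closed_cbox)
      ultimately show "\<Delta> k \<in> sets \<mu>"
        unfolding sets by (auto simp: sets_restrict_space intro!: image_eqI[of _ _ "\<Delta> k"])
    qed measurable
    also have "\<dots> \<le> (\<Sum>k. ennreal B * A k)"
      by (intro suminf_le cube_le) auto
    also have "\<dots> = ennreal B * (\<Sum>k. A k)" by simp
    also have "\<dots> \<le> ennreal B * (of_nat N * (\<integral>\<^sup>+Z. ?h Z \<partial>?M))"
      unfolding A_def
      by (intro mult_left_mono suminf_nn_integral_overlap_le h_meas Q_sets Q_overlap) auto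
    also have "\<dots> = ennreal (B * real N) * (\<integral>\<^sup>+Z. ?h Z \<partial>?M)"
      using B by (simp add: ennreal_mult ennreal_of_nat_eq_real_of_nat mult.assoc)
    finally show "(\<integral>\<^sup>+z. ennreal (norm (Tr f z) powr p) \<partial>\<mu>) \<le> ennreal (B * real N) * (\<integral>\<^sup>+Z. ?h Z \<partial>?M)" .
  qed
qed

lemma trace_bounded_mono: "trace_bounded X p s \<mu> \<Longrightarrow> Y \<subseteq> X \<Longrightarrow> trace_bounded Y p s \<mu>"
  unfolding trace_bounded_def by blast

theorem theorem2:
  fixes p :: real and s :: "'m::finite \<Rightarrow> real"
    and \<mu> :: "'n::finite point measure" and \<Delta> :: "nat \<Rightarrow> 'n point set"
  assumes "0 < p"
    and "\<And>j. s j > -1"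
    and "sets \<mu> = sets (restrict_space borel halfspace)"
    and "whitney_decomposition \<Delta>"
  shows "(carleson \<Delta> s \<mu> \<longleftrightarrow> trace_bounded (bergman_pow p s) p s \<mu>) \<and>
    (carleson \<Delta> s \<mu> \<longleftrightarrow> trace_bounded (sep_bergman_pow p s) p s \<mu>) \<and>
    (carleson \<Delta> s \<mu> \<longleftrightarrow> product_bounded p s \<mu>)"
proof -
  have "carleson \<Delta> s \<mu> \<Longrightarrow> trace_bounded (bergman_pow p s) p s \<mu>"
    using assms by (intro carleson_imp_trace_bounded)
  moreover have "trace_bounded (bergman_pow p s) p s \<mu> \<Longrightarrow> trace_bounded (sep_bergman_pow p s) p s \<mu>"
    by (erule trace_bounded_mono) (simp add: sep_bergman_pow_def)
  moreover have "trace_bounded (sep_bergman_pow p s) p s \<mu> \<Longrightarrow> product_bounded p s \<mu>"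
    using \<open>0 < p\<close> by (rule trace_bounded_imp_product_bounded)
  moreover have "product_bounded p s \<mu> \<Longrightarrow> carleson \<Delta> s \<mu>"
    using assms by (intro product_bounded_imp_carleson)
  ultimately show ?thesis by blast
qed

end
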